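(* Suppose $G$ is a finitely generated large group. Then $\operatorname{girth}(G)=\infty$.
   Context: A group $G$ is large if it has a finite-index subgroup that admits a surjective homomorphism onto the free group $F_2$ of rank $2$. For a finitely generated group $G$ and a finite generating set $S$ of $G$, let $\operatorname{girth}(G,S)$ be the minimal length of a non-empty freely reduced word in the letters $S^{\pm 1}$ (i.e. a non-trivial element of the free group on $S$) that represents the identity of $G$, with $\operatorname{girth}(G,S)=\infty$ if there is no such word. The girth of $G$ is $\operatorname{girth}(G)=\sup_S \operatorname{girth}(G,S)$, the supremum being over all finite generating sets $S$ of $G$. *)

theory Defs
  imports "HOL-Algebra.Generated_Groups" "HOL-Library.Extended_Nat"
begin

text \<open>
  A letter over an alphabet \<open>S\<close> is a pair \<open>(s, b)\<close> with \<open>s \<in> S\<close>; it stands for the formal symbol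
  \<open>s\<close> if \<open>b\<close> is true and for the formal inverse of \<open>s\<close> otherwise. Thus, even if \<open>S\<close> is a subset
  of a group in which \<open>s\<close> is an involution, or contains both \<open>s\<close> and the inverse of \<open>s\<close>,
  the letters are pairwise distinct.
\<close>

definition letter_inv :: "'a \<times> bool \<Rightarrow> 'a \<times> bool" where
  "letter_inv x = (fst x, \<not> snd x)"

definition freely_reduced :: "('a \<times> bool) list \<Rightarrow> bool" where
  "freely_reduced w \<longleftrightarrow> successively (\<lambda>x y. y \<noteq> letter_inv x) w"

definition cancel_cons :: "'a \<times> bool \<Rightarrow> ('a \<times> bool) list \<Rightarrow> ('a \<times> bool) list" where
  "cancel_cons x w = (if w \<noteq> [] \<and> hd w = letter_inv x then tl w else x # w)"

definition free_reduce :: "('a \<times> bool) list \<Rightarrow> ('a \<times> bool) list" where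
  "free_reduce w = foldr cancel_cons w []"

definition reduced_words :: "'a set \<Rightarrow> ('a \<times> bool) list set" where
  "reduced_words S = {w \<in> lists (S \<times> UNIV). freely_reduced w}"

definition free_group :: "'a set \<Rightarrow> ('a \<times> bool) list monoid" where
  "free_group S = \<lparr>carrier = reduced_words S,
                   monoid.mult = (\<lambda>v w. free_reduce (v @ w)),
                   one = []\<rparr>"

definition eval_letter :: "('a, 'b) monoid_scheme \<Rightarrow> 'a \<times> bool \<Rightarrow> 'a" where
  "eval_letter G x = (if snd x then fst x else inv\<^bsub>G\<^esub> (fst x))"

definition eval_word :: "('a, 'b) monoid_scheme \<Rightarrow> ('a \<times> bool) list \<Rightarrow> 'a" where
  "eval_word G w = foldr (\<lambda>x g. eval_letter G x \<otimes>\<^bsub>G\<^esub> g) w \<one>\<^bsub>G\<^esub>"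

definition finite_generating_sets :: "('a, 'b) monoid_scheme \<Rightarrow> 'a set set" where
  "finite_generating_sets G = {S. finite S \<and> S \<subseteq> carrier G \<and> generate G S = carrier G}"

definition finitely_generated_group :: "('a, 'b) monoid_scheme \<Rightarrow> bool" where
  "finitely_generated_group G \<longleftrightarrow> group G \<and> finite_generating_sets G \<noteq> {}"

definition large_group :: "('a, 'b) monoid_scheme \<Rightarrow> bool" where
  "large_group G \<longleftrightarrow> group G \<and>
     (\<exists>H. subgroup H G \<and> finite (rcosets\<^bsub>G\<^esub> H) \<and>
          epi (G\<lparr>carrier := H\<rparr>) (free_group {0, 1 :: nat}) \<noteq> {})"

text \<open>The infimum of the empty set is \<open>\<infinity>\<close> in \<open>enat\<close>; every nonempty set of \<open>enat\<close> attains its infimum.\<close>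

definition girth_wrt :: "('a, 'b) monoid_scheme \<Rightarrow> 'a set \<Rightarrow> enat" where
  "girth_wrt G S = (INF w \<in> {w \<in> reduced_words S. w \<noteq> [] \<and> eval_word G w = \<one>\<^bsub>G\<^esub>}. enat (length w))"

definition girth :: "('a, 'b) monoid_scheme \<Rightarrow> enat" where
  "girth G = (SUP S \<in> finite_generating_sets G. girth_wrt G S)"


lemma letter_inv_invol [simp]: "letter_inv (letter_inv x) = x"
  by (simp add: letter_inv_def)

lemma letter_inv_neq [simp]: "letter_inv x \<noteq> x"
  by (cases x) (simp add: letter_inv_def)

lemma freely_reduced_Nil [simp]: "freely_reduced []"
  by (simp add: freely_reduced_def)

lemma freely_reduced_Cons:
  "freely_reduced (x # w) \<longleftrightarrow> freely_reduced w \<and> (w = [] \<or> hd w \<noteq> letter_inv x)"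
  by (auto simp: freely_reduced_def successively_Cons)

lemma freely_reduced_cancel_cons:
  "freely_reduced w \<Longrightarrow> freely_reduced (cancel_cons x w)"
  by (cases w) (auto simp: cancel_cons_def freely_reduced_Cons)

lemma freely_reduced_foldr:
  "freely_reduced w \<Longrightarrow> freely_reduced (foldr cancel_cons v w)"
  by (induction v) (auto intro: freely_reduced_cancel_cons)

lemma cancel_cons_inv:
  "freely_reduced w \<Longrightarrow> cancel_cons x (cancel_cons (letter_inv x) w) = w"
  by (cases w) (auto simp: cancel_cons_def freely_reduced_Cons neq_Nil_conv)

lemma foldr_cancel_cons:
  assumes "freely_reduced w"
  shows "foldr cancel_cons (cancel_cons x v) w = cancel_cons x (foldr cancel_cons v w)"
proof (cases "v \<noteq> [] \<and> hd v = letter_inv x")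
  case True
  then have "v = letter_inv x # tl v"
    by (metis list.collapse)
  then have "foldr cancel_cons v w = cancel_cons (letter_inv x) (foldr cancel_cons (tl v) w)"
    by (metis foldr.simps(2) comp_apply)
  then show ?thesis
    using True assms by (simp add: cancel_cons_def[of x v] cancel_cons_inv freely_reduced_foldr)
qed (auto simp: cancel_cons_def[of x v])

lemma foldr_free_reduce:
  "freely_reduced w \<Longrightarrow> foldr cancel_cons (free_reduce v) w = foldr cancel_cons v w"
  by (induction v) (simp_all add: free_reduce_def foldr_cancel_cons)

lemma free_reduce_id: "freely_reduced w \<Longrightarrow> free_reduce w = w"
  by (induction w) (auto simp: free_reduce_def freely_reduced_Cons cancel_cons_def)

lemma free_reduce_append: "freely_reduced w \<Longrightarrow> free_reduce (v @ w) = foldr cancel_cons v w"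
  using free_reduce_id[of w] by (simp add: free_reduce_def)

lemma cancel_cons_lists:
  "x \<in> A \<Longrightarrow> w \<in> lists A \<Longrightarrow> cancel_cons x w \<in> lists A"
  by (cases w) (auto simp: cancel_cons_def)

lemma free_reduce_in_reduced_words:
  "w \<in> lists (S \<times> UNIV) \<Longrightarrow> free_reduce w \<in> reduced_words S"
proof -
  assume "w \<in> lists (S \<times> UNIV)"
  then have "foldr cancel_cons w [] \<in> lists (S \<times> UNIV)"
    by (induction w) (simp_all add: cancel_cons_lists del: in_lists_conv_set)
  then show ?thesis
    by (simp add: reduced_words_def free_reduce_def freely_reduced_foldr)
qed

lemma foldr_inverse:
  "freely_reduced w \<Longrightarrow> foldr cancel_cons (rev (map letter_inv v)) (foldr cancel_cons v w) = w"
proof (induction v)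
  case (Cons x v)
  then show ?case
    using cancel_cons_inv[OF freely_reduced_foldr[of w v], of "letter_inv x"] by simp
qed simp

theorem group_free_group: "group (free_group S)"
proof (rule groupI)
  fix u v w
  assume u: "u \<in> carrier (free_group S)" and v: "v \<in> carrier (free_group S)"
    and w: "w \<in> carrier (free_group S)"
  show "u \<otimes>\<^bsub>free_group S\<^esub> v \<in> carrier (free_group S)"
    using u v free_reduce_in_reduced_words[of "u @ v" S]
    by (simp add: free_group_def reduced_words_def)
  have r: "freely_reduced v" "freely_reduced w"
    using v w by (auto simp: free_group_def reduced_words_def)
  have "free_reduce (free_reduce (u @ v) @ w) = foldr cancel_cons (u @ v) w"
    using r(2) by (simp only: free_reduce_append[OF r(2)] foldr_free_reduce)
  also have "\<dots> = free_reduce (u @ free_reduce (v @ w))"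
    using r by (simp add: free_reduce_append freely_reduced_foldr)
  finally show "u \<otimes>\<^bsub>free_group S\<^esub> v \<otimes>\<^bsub>free_group S\<^esub> w
      = u \<otimes>\<^bsub>free_group S\<^esub> (v \<otimes>\<^bsub>free_group S\<^esub> w)"
    by (simp add: free_group_def)
next
  show "\<one>\<^bsub>free_group S\<^esub> \<in> carrier (free_group S)"
    by (simp add: free_group_def reduced_words_def)
next
  fix w assume w: "w \<in> carrier (free_group S)"
  then show "\<one>\<^bsub>free_group S\<^esub> \<otimes>\<^bsub>free_group S\<^esub> w = w"
    by (simp add: free_group_def reduced_words_def free_reduce_id)
  define v where "v = free_reduce (rev (map letter_inv w))"
  have r: "freely_reduced w" and "rev (map letter_inv w) \<in> lists (S \<times> UNIV)"
    using w by (fastforce simp: free_group_def reduced_words_def letter_inv_def)+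
  then have "v \<in> carrier (free_group S)"
    by (simp only: v_def free_group_def free_reduce_in_reduced_words partial_object.simps)
  moreover have "free_reduce (v @ w) = foldr cancel_cons (rev (map letter_inv w)) w"
    using r by (simp only: v_def free_reduce_append foldr_free_reduce)
  then have "free_reduce (v @ w) = []"
    using foldr_inverse[of "[]" w] free_reduce_id[OF r] by (simp add: free_reduce_def)
  then have "v \<otimes>\<^bsub>free_group S\<^esub> w = \<one>\<^bsub>free_group S\<^esub>"
    by (simp add: free_group_def)
  ultimately show "\<exists>v\<in>carrier (free_group S). v \<otimes>\<^bsub>free_group S\<^esub> w = \<one>\<^bsub>free_group S\<^esub>"
    by blast
qed

end

theory Submission
  imports Defs "HOL-Analysis.Analysis"
begin

text \<open>
  The free group of rank two embeds into \<open>SL\<^sub>2(\<real>)\<close> as a Schottky group, in which every element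
  other than the identity is hyperbolic, i.e. has a trace of absolute value greater than 2
  (\<open>hyperbolic_word_matrix\<close>). A large group \<open>G\<close> thus has a subgroup \<open>H\<close> of finite index and a
  homomorphism \<open>\<theta>\<close> from \<open>H\<close> to \<open>SL\<^sub>2(\<real>)\<close> with noncommutative image, all of whose values are
  hyperbolic or trivial. Such a family of matrices behaves like a free group for two reasons. Two
  elements with a common eigenvector commute, as their commutator would have trace 2; hence
  commuting is a transitive relation between nontrivial elements. And a product
  \<open>r\<^sub>1\<^sup>M r\<^sub>2\<^sup>M \<dots> r\<^sub>k\<^sup>M\<close> in which neighbours do not commute grows exponentially with \<open>M\<close>, so
  that it differs from any prescribed matrix once \<open>M\<close> is large
  (\<open>power_product_eventually_neq\<close>).

  Let \<open>g\<^sub>2, \<dots>, g\<^sub>m\<^sub>-\<^sub>1\<close> generate \<open>G\<close> and fix a bound on the length of words. The new generating set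
  consists of two elements \<open>h\<^sub>0, h\<^sub>1\<close> and of
  \<open>t\<^sub>i = p\<^sub>i\<^sup>M g\<^sub>i q\<^sub>i\<^sup>M\<close>, with \<open>p\<^sub>i\<close> and \<open>q\<^sub>i\<close> in the subgroup \<open>D\<close> generated by
  \<open>h\<^sub>0\<close> and \<open>h\<^sub>1\<close>, so that each \<open>g\<^sub>i\<close> can be recovered. All of \<open>h\<^sub>i, p\<^sub>i, q\<^sub>i\<close> lie in the normal core
  of \<open>H\<close>, where \<open>\<theta>\<close> can be applied to every conjugate. Pushing the \<open>h\<^sub>i\<close> and \<open>g\<^sub>i\<close> to the right turns
  a word in the new generators into a product of \<open>M\<close>-th powers of conjugates of the
  \<open>p\<^sub>i\<^sup>\<plusminus>\<^sup>1\<close> and \<open>q\<^sub>i\<^sup>\<plusminus>\<^sup>1\<close>, times an element that does not depend on \<open>M\<close>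
  (\<open>tuple_eval_sandwich\<close>). The conjugating elements are values of short words in the \<open>h\<^sub>i\<close>
  and \<open>g\<^sub>i\<close>, so they come from a finite set that is known before the \<open>p\<^sub>i\<close> and \<open>q\<^sub>i\<close> are chosen. If
  neighbours in this product never commute, the word is nontrivial for large \<open>M\<close>.

  Neighbours that come from different elements among the \<open>p\<^sub>i, q\<^sub>i\<close> are kept from commuting by
  the choice of these elements one after another: each of the finitely many
  conditions excludes from \<open>D\<close> a proper subgroup that is closed under roots, and a group
  is not a finite union of such subgroups (\<open>avoid_root_closed_subgroups\<close>). The two sides of
  \<open>g\<^sub>i\<close> use different elements \<open>p\<^sub>i\<close> and \<open>q\<^sub>i\<close> precisely in order that the remaining case, a
  conjugate of some \<open>q\<^sub>i\<close> (or \<open>p\<^sub>i\<close>) next to a conjugate of its own inverse, arises only in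
  \<open>t\<^sub>i u t\<^sub>i\<inverse>\<close> or \<open>t\<^sub>i\<inverse> u t\<^sub>i\<close>
  with a nonempty reduced word \<open>u\<close> in \<open>h\<^sub>0, h\<^sub>1\<close> between them. There it
  suffices that \<open>q\<^sub>i\<close> does not commute with \<open>u\<close>, which is again such a condition, as
  short words in \<open>h\<^sub>0, h\<^sub>1\<close> are nontrivial in every conjugate (\<open>free_pair\<close>). With \<open>p\<^sub>i = q\<^sub>i\<close> this
  would fail: if conjugation by \<open>g\<^sub>i\<close> inverts \<open>p\<^sub>i\<close>, then \<open>p\<^sub>i\<^sup>M g\<^sub>i p\<^sub>i\<^sup>M = g\<^sub>i\<close> for every \<open>M\<close>.
\<close>

section \<open>Hyperbolic matrices\<close>

text \<open>
  For determinant 1 this means that the eigenvalues are \<open>c\<close> and \<open>1 / c\<close> with \<open>\<bar>c\<bar> > 1\<close>.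
\<close>

definition hyperbolic :: "real^2^2 \<Rightarrow> bool" where
  "hyperbolic m \<longleftrightarrow> det m = 1 \<and> \<bar>trace m\<bar> > 2"

lemmas mat2_simps = matrix_matrix_mult_def matrix_vector_mult_def sum_2 det_2 trace_def mat_def
  vec_eq_iff forall_2

lemma cayley_hamilton_2:
  fixes m :: "real^2^2"
  shows "m *v (m *v x) = trace m *\<^sub>R (m *v x) - det m *\<^sub>R x"
  by (simp add: mat2_simps) (simp add: algebra_simps)

lemma eigenvalue_trace:
  fixes m :: "real^2^2"
  assumes "det m = 1" "m *v x = c *\<^sub>R x" "x \<noteq> 0"
  shows "c \<noteq> 0" "trace m = c + 1 / c"
proof -
  have "(c * c) *\<^sub>R x = (trace m * c) *\<^sub>R x - x"
    using cayley_hamilton_2[of m x] assms by (simp add: matrix_vector_mult_scaleR)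
  then have "(c * c - trace m * c + 1) *\<^sub>R x = 0"
    by (simp add: algebra_simps)
  then have *: "c * c - trace m * c + 1 = 0"
    using assms(3) by simp
  then show "c \<noteq> 0" by auto
  then show "trace m = c + 1 / c"
    using * by (simp add: field_simps)
qed

lemma inverse_gap:
  assumes "\<bar>c\<bar> > (1::real)"
  shows "\<bar>1 / c\<bar> < 1" "c - 1 / c \<noteq> 0"
proof -
  show "\<bar>1 / c\<bar> < 1" using assms by (simp add: field_simps)
  then show "c - 1 / c \<noteq> 0" using assms by (metis eq_iff_diff_eq_0 order.asym)
qed

lemma hyperbolic_eigenvalue:
  assumes "hyperbolic m"
  obtains c :: real where "\<bar>c\<bar> > 1" "trace m = c + 1 / c"
proof -
  define t where "t = trace m"
  have t: "\<bar>t\<bar> > 2" using assms by (simp add: hyperbolic_def t_def)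
  define s where "s = sqrt (t\<^sup>2 - 4)"
  have "t\<^sup>2 > 2\<^sup>2"
    using t by (metis abs_le_square_iff abs_numeral linorder_not_le power2_abs)
  then have s: "s\<^sup>2 = t\<^sup>2 - 4" "s > 0" by (simp_all add: s_def)
  define c where "c = (t + sgn t * s) / 2"
  have ct: "c * (t - c) = 1"
    using s(1) t by (auto simp: c_def sgn_real_def field_simps power2_eq_square)
  have c1: "\<bar>c\<bar> > 1" using s t by (auto simp: c_def sgn_real_def abs_real_def split: if_splits)
  then have "t = c + 1 / c" using ct by (auto simp: field_simps)
  with c1 show ?thesis using that by (simp add: t_def)
qed

text \<open>
  If an eigenspace were the whole plane, the matrix would be \<open>c\<close> times the identity; then
  \<open>c\<^sup>2 = 1\<close> and the trace would be \<open>2 c\<close>, of absolute value 2.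
\<close>

lemma hyperbolic_eigenspace:
  assumes "hyperbolic m" "m *v x = c *\<^sub>R x" "x \<noteq> 0" "m *v y = c *\<^sub>R y"
  obtains k where "y = k *\<^sub>R x"
proof -
  have m: "det m = 1" "\<bar>trace m\<bar> > 2" using assms(1) by (auto simp: hyperbolic_def)
  have "x$1 * y$2 = x$2 * y$1"
  proof (rule ccontr)
    assume d: "x$1 * y$2 \<noteq> x$2 * y$1"
    have e: "m$1$1 * x$1 + m$1$2 * x$2 = c * x$1" "m$2$1 * x$1 + m$2$2 * x$2 = c * x$2"
      "m$1$1 * y$1 + m$1$2 * y$2 = c * y$1" "m$2$1 * y$1 + m$2$2 * y$2 = c * y$2"
      using assms(2,4) by (simp_all add: mat2_simps)
    have "m$1$2 * (x$1 * y$2 - x$2 * y$1) = 0" "(m$1$1 - c) * (x$1 * y$2 - x$2 * y$1) = 0"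
      "m$2$1 * (x$1 * y$2 - x$2 * y$1) = 0" "(m$2$2 - c) * (x$1 * y$2 - x$2 * y$1) = 0"
      using e by algebra+
    then have "m$1$2 = 0" "m$1$1 = c" "m$2$2 = c" using d by auto
    then have "c * c = 1" "\<bar>c + c\<bar> > 2" using m by (simp_all add: mat2_simps)
    then show False by (metis abs_mult_self_eq abs_one mult_2 abs_mult abs_numeral square_eq_1_iff
      mult.right_neutral less_irrefl abs_minus_cancel)
  qed
  moreover have "x$1 \<noteq> 0 \<or> x$2 \<noteq> 0" using assms(3) by (simp add: vec_eq_iff forall_2)
  ultimately have "y = (if x$1 \<noteq> 0 then y$1 / x$1 else y$2 / x$2) *\<^sub>R x"
    by (auto simp: vec_eq_iff forall_2 field_simps)
  then show ?thesis using that by blast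
qed

text \<open>
  Applied to a commutator, this shows that hyperbolic matrices with a common eigenvector commute.
\<close>

lemma not_hyperbolic_fixed_vector:
  assumes "m *v x = x" "x \<noteq> (0::real^2)"
  shows "\<not> hyperbolic m"
  using eigenvalue_trace(2)[of m x 1] assms by (auto simp: hyperbolic_def)

text \<open>
  \<open>P\<close> is the projection to the eigenline of the large eigenvalue \<open>c\<close> along that of \<open>1 / c\<close>: after
  rescaling, high powers of \<open>m\<close> converge to it. The vector may vary with the exponent, because the
  result is applied to products of powers with a common exponent, from right to left.
\<close>

lemma hyperbolic_powers_limit:
  fixes u :: "nat \<Rightarrow> real^2"
  assumes m: "hyperbolic m" and c: "\<bar>c\<bar> > 1" "trace m = c + 1 / c" and u: "u \<longlonglongrightarrow> x"
  defines "P \<equiv> \<lambda>y. (1 / (c - 1 / c)) *\<^sub>R (m *v y - (1 / c) *\<^sub>R y)"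
  shows "(\<lambda>n. (1 / c) ^ n *\<^sub>R (((*v) m ^^ n) (u n))) \<longlonglongrightarrow> P x"
    and "m *v P x = c *\<^sub>R P x"
proof -
  have c0: "c \<noteq> 0" using c by auto
  have "\<bar>1 / c\<bar> < 1" "c - 1 / c \<noteq> 0" using inverse_gap[OF c(1)] .
  define d where "d = 1 / (c - 1 / c)"
  have d: "d * (c - 1 / c) = 1" using \<open>c - 1 / c \<noteq> 0\<close> by (simp add: d_def)
  define R where "R = (\<lambda>y. d *\<^sub>R (c *\<^sub>R y - m *v y))"
  have PR: "P y + R y = y" for y
  proof -
    have "d *\<^sub>R (a - e *\<^sub>R y) + d *\<^sub>R (c *\<^sub>R y - a) = (d * (c - e)) *\<^sub>R y" for a e
      by (simp add: algebra_simps)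
    then have "P y + R y = (d * (c - 1 / c)) *\<^sub>R y"
      unfolding P_def R_def d_def[symmetric] .
    then show ?thesis by (simp add: d)
  qed
  have ch: "m *v (m *v y) = (c + 1 / c) *\<^sub>R (m *v y) - y" for y
    using cayley_hamilton_2[of m y] m c by (simp add: hyperbolic_def)
  have mP: "m *v P y = c *\<^sub>R P y" for y
    by (simp add: P_def matrix_vector_mult_scaleR matrix_vector_mult_diff_distrib ch)
       (simp add: algebra_simps c0)
  have mR: "m *v R y = (1 / c) *\<^sub>R R y" for y
    by (simp add: R_def matrix_vector_mult_scaleR matrix_vector_mult_diff_distrib ch)
       (simp add: algebra_simps c0)
  show "m *v P x = c *\<^sub>R P x" by (rule mP)
  have pow: "((*v) m ^^ n) y = c ^ n *\<^sub>R P y + (1 / c) ^ n *\<^sub>R R y" for n y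
  proof (induction n)
    case 0
    then show ?case by (simp add: PR)
  next
    case (Suc n)
    then show ?case
      by (simp add: matrix_vector_right_distrib matrix_vector_mult_scaleR mP mR)
  qed
  have eq: "(1 / c) ^ n *\<^sub>R (((*v) m ^^ n) y) = P y + ((1 / c) ^ n * (1 / c) ^ n) *\<^sub>R R y" for n y
    using c0 by (simp add: pow scaleR_add_right flip: power_mult_distrib)
  have z: "(\<lambda>n. (1 / c) ^ n) \<longlonglongrightarrow> 0"
    using \<open>\<bar>1 / c\<bar> < 1\<close> by (intro LIMSEQ_power_zero) simp
  have mu: "(\<lambda>n. m *v u n) \<longlonglongrightarrow> m *v x"
    by (rule bounded_linear.tendsto[OF matrix_vector_mul_bounded_linear u])
  have "(\<lambda>n. P (u n)) \<longlonglongrightarrow> P x" unfolding P_def by (intro tendsto_intros mu u)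
  moreover have "(\<lambda>n. R (u n)) \<longlonglongrightarrow> R x" unfolding R_def by (intro tendsto_intros mu u)
  ultimately have "(\<lambda>n. P (u n) + ((1 / c) ^ n * (1 / c) ^ n) *\<^sub>R R (u n)) \<longlonglongrightarrow> P x + (0 * 0) *\<^sub>R R x"
    by (intro tendsto_intros z)
  then show "(\<lambda>n. (1 / c) ^ n *\<^sub>R (((*v) m ^^ n) (u n))) \<longlonglongrightarrow> P x"
    by (simp add: eq)
qed

text \<open>
  The image of the projection \<open>P\<close> consists of eigenvectors for \<open>c\<close>. If it were trivial, then \<open>m\<close>
  would be \<open>1 / c\<close> times the identity, of trace less than 2.
\<close>

lemma hyperbolic_eigenvector:
  assumes "hyperbolic m"
  obtains c v where "\<bar>c\<bar> > 1" "trace m = c + 1 / c" "v \<noteq> 0" "m *v v = c *\<^sub>R v"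
proof -
  obtain c where c: "\<bar>c\<bar> > 1" "trace m = c + 1 / c" using hyperbolic_eigenvalue[OF assms] .
  define P where "P = (\<lambda>y. (1 / (c - 1 / c)) *\<^sub>R (m *v y - (1 / c) *\<^sub>R y))"
  have e: "m *v P y = c *\<^sub>R P y" for y
    unfolding P_def by (rule hyperbolic_powers_limit(2)[OF assms c tendsto_const])
  have "\<exists>y. P y \<noteq> 0"
  proof (rule ccontr)
    assume "\<nexists>y. P y \<noteq> 0"
    then have m: "m *v y = (1 / c) *\<^sub>R y" for y
      using inverse_gap(2)[OF c(1)] by (simp add: P_def)
    have "m$1$1 = 1 / c" "m$2$2 = 1 / c"
      using m[of "vector [1, 0]"] m[of "vector [0, 1]"] by (simp_all add: mat2_simps)
    then have "\<bar>trace m\<bar> = 2 * \<bar>1 / c\<bar>" by (simp add: trace_def sum_2)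
    then show False using inverse_gap(1)[OF c(1)] assms by (simp add: hyperbolic_def)
  qed
  then show ?thesis using that[OF c] e by blast
qed

section \<open>A free group of hyperbolic matrices\<close>

text \<open>
  The two generators are symmetric matrices with eigenvalues 9 and \<open>1/9\<close>, whose eigenlines are the
  coordinate axes and the diagonals, respectively. The factor 9 is large enough for the cones below
  to be mapped into each other.
\<close>

definition letter_matrix :: "nat \<times> bool \<Rightarrow> real^2^2" where
  "letter_matrix l =
     (if fst l = 0
      then if snd l then vector [vector [9, 0], vector [0, 1/9]]
           else vector [vector [1/9, 0], vector [0, 9]]
      else if snd l then vector [vector [41/9, 40/9], vector [40/9, 41/9]]
           else vector [vector [41/9, -40/9], vector [-40/9, 41/9]])"

text \<open>
  The axis of a letter spans the eigenline of its matrix for the eigenvalue 9; the axis of the inverse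
  letter is orthogonal to it and belongs to \<open>1/9\<close>.
\<close>

definition schottky_axis :: "nat \<times> bool \<Rightarrow> real^2" where
  "schottky_axis l = (if fst l = 0 then if snd l then vector [1, 0] else vector [0, 1]
             else if snd l then vector [1, 1] else vector [1, -1])"

definition word_matrix :: "(nat \<times> bool) list \<Rightarrow> real^2^2" where
  "word_matrix w = foldr (\<lambda>l m. letter_matrix l ** m) w (mat 1)"

lemma word_matrix_simps [simp]:
  "word_matrix [] = mat 1"
  "word_matrix (l # w) = letter_matrix l ** word_matrix w"
  by (simp_all add: word_matrix_def)

lemma word_matrix_append: "word_matrix (v @ w) = word_matrix v ** word_matrix w"
  by (induction v) (simp_all add: matrix_mul_assoc)

lemma letter_matrix_inv: "letter_matrix l ** letter_matrix (letter_inv l) = mat 1"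
  by (simp add: letter_matrix_def letter_inv_def mat2_simps)

lemma det_word_matrix: "det (word_matrix w) = 1"
proof (induction w)
  case (Cons l w)
  have "det (letter_matrix l) = 1" by (simp add: letter_matrix_def det_2)
  with Cons show ?case by (simp add: det_mul)
qed simp

text \<open>
  Together with \<open>word_matrix_append\<close> this makes \<open>word_matrix\<close> a homomorphism on the free group, whose
  product is concatenation followed by reduction.
\<close>

lemma word_matrix_cancel_cons: "word_matrix (cancel_cons l w) = letter_matrix l ** word_matrix w"
proof (cases "w \<noteq> [] \<and> hd w = letter_inv l")
  case True
  then obtain v where "w = letter_inv l # v" by (cases w) auto
  then show ?thesis by (simp add: cancel_cons_def matrix_mul_assoc letter_matrix_inv)
qed (auto simp: cancel_cons_def)

lemma word_matrix_free_reduce: "word_matrix (free_reduce w) = word_matrix w"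
  by (induction w) (simp_all add: free_reduce_def word_matrix_cancel_cons)

text \<open>
  A double cone around the axis of \<open>l\<close>. The ratio 3 makes the four cones disjoint apart from 0: their
  half-angle has tangent \<open>1/3\<close>, and neighbouring axes are 45 degrees apart.
\<close>

definition schottky_cone :: "nat \<times> bool \<Rightarrow> (real^2) set" where
  "schottky_cone l = {v. 3 * \<bar>schottky_axis (letter_inv l) \<bullet> v\<bar> \<le> \<bar>schottky_axis l \<bullet> v\<bar>}"

text \<open>
  The ping-pong step: a letter contracts towards its axis every cone except that of its
  inverse, the only one whose vectors have a small component along this axis.
\<close>

lemma letter_matrix_schottky_cone:
  assumes "v \<in> schottky_cone k" "l \<noteq> letter_inv k" "fst k \<in> {0,1}" "fst l \<in> {0,1}"
  shows "letter_matrix l *v v \<in> schottky_cone l" "\<bar>schottky_axis l \<bullet> (letter_matrix l *v v)\<bar> \<ge> 3 * \<bar>schottky_axis k \<bullet> v\<bar>"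
proof -
  obtain i e j f where kl: "k = (i, e)" "l = (j, f)" by fastforce
  have "i = 0 \<or> i = 1" "j = 0 \<or> j = 1" using assms kl by auto
  then show "letter_matrix l *v v \<in> schottky_cone l"
    "\<bar>schottky_axis l \<bullet> (letter_matrix l *v v)\<bar> \<ge> 3 * \<bar>schottky_axis k \<bullet> v\<bar>"
    using assms(1,2) unfolding kl
    by (cases e; cases f; auto simp: schottky_cone_def schottky_axis_def letter_matrix_def letter_inv_def inner_vec_def mat2_simps abs_real_def
      split: if_splits)+
qed

lemma word_matrix_schottky_cone:
  assumes "w \<noteq> []" "freely_reduced w" "fst ` set w \<subseteq> {0,1}" "v \<in> schottky_cone k" "fst k \<in> {0,1}"
    "last w \<noteq> letter_inv k"
  shows "word_matrix w *v v \<in> schottky_cone (hd w) \<and>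
    \<bar>schottky_axis (hd w) \<bullet> (word_matrix w *v v)\<bar> \<ge> 3 * \<bar>schottky_axis k \<bullet> v\<bar>"
  using assms(1-3,6)
proof (induction w)
  case (Cons l w)
  show ?case
  proof (cases "w = []")
    case True
    then show ?thesis using letter_matrix_schottky_cone[OF assms(4), of l] Cons assms by simp
  next
    case False
    then have IH: "word_matrix w *v v \<in> schottky_cone (hd w)"
      "\<bar>schottky_axis (hd w) \<bullet> (word_matrix w *v v)\<bar> \<ge> 3 * \<bar>schottky_axis k \<bullet> v\<bar>"
      using Cons by (auto simp: freely_reduced_Cons)
    have "l \<noteq> letter_inv (hd w)" using Cons False
      by (metis freely_reduced_Cons letter_inv_invol)
    moreover have "fst (hd w) \<in> {0,1}" "fst l \<in> {0,1}" using Cons.prems False by (auto simp: image_subset_iff)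
    ultimately have "letter_matrix l *v (word_matrix w *v v) \<in> schottky_cone l"
      "\<bar>schottky_axis l \<bullet> (letter_matrix l *v (word_matrix w *v v))\<bar> \<ge> 3 * \<bar>schottky_axis (hd w) \<bullet> (word_matrix w *v v)\<bar>"
      using letter_matrix_schottky_cone[OF IH(1)] by blast+
    then show ?thesis using IH(2) by (simp add: matrix_vector_mul_assoc)
  qed
qed simp

lemma schottky_axis_inner: "schottky_axis l \<bullet> schottky_axis (letter_inv l) = 0" "schottky_axis l \<bullet> schottky_axis l > 0"
  "schottky_axis (letter_inv l) \<bullet> schottky_axis (letter_inv l) = schottky_axis l \<bullet> schottky_axis l"
  by (auto simp: schottky_axis_def letter_inv_def inner_vec_def sum_2)

lemma schottky_axis_span: "(schottky_axis l \<bullet> schottky_axis l) *\<^sub>R v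
    = (schottky_axis l \<bullet> v) *\<^sub>R schottky_axis l
      + (schottky_axis (letter_inv l) \<bullet> v) *\<^sub>R schottky_axis (letter_inv l)"
  by (auto simp: schottky_axis_def letter_inv_def inner_vec_def mat2_simps)

text \<open>
  A cyclically reduced word maps the cone of its first letter to itself. By the intermediate
  value theorem, applied to the slopes of lines in the cone, one of these lines is preserved, and
  on it the matrix multiplies lengths by at least 3. Since the determinant is 1, the trace is
  \<open>c + 1 / c\<close> with \<open>\<bar>c\<bar> \<ge> 3\<close>.
\<close>

lemma hyperbolic_cyclically_reduced:
  assumes w: "w \<noteq> []" "freely_reduced w" "fst ` set w \<subseteq> {0,1}" and cyc: "last w \<noteq> letter_inv (hd w)"
  shows "hyperbolic (word_matrix w)"
proof -
  define l where "l = hd w"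
  define m where "m = word_matrix w"
  define a b d where "a = schottky_axis l" and "b = schottky_axis (letter_inv l)" and "d = a \<bullet> a"
  define v where "v t = a + t *\<^sub>R b" for t
  have ab: "a \<bullet> b = 0" "d > 0" "b \<bullet> b = d" using schottky_axis_inner[of l] by (auto simp: a_def b_def d_def)
  have av: "a \<bullet> v t = d" "b \<bullet> v t = t * d" for t
    using ab by (auto simp: v_def d_def inner_add_right inner_commute)
  have l01: "fst l \<in> {0,1}" using w by (auto simp: l_def image_subset_iff)
  have key: "3 * \<bar>b \<bullet> (m *v v t)\<bar> \<le> \<bar>a \<bullet> (m *v v t)\<bar>" "\<bar>a \<bullet> (m *v v t)\<bar> \<ge> 3 * d" if "\<bar>t\<bar> \<le> 1/3" for t
  proof -
    have "v t \<in> schottky_cone l" using that ab(2) by (simp add: schottky_cone_def av flip: a_def b_def) (simp add: abs_mult)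
    then have "m *v v t \<in> schottky_cone l \<and> \<bar>schottky_axis l \<bullet> (m *v v t)\<bar> \<ge> 3 * \<bar>schottky_axis l \<bullet> v t\<bar>"
      unfolding m_def l_def using w cyc l01 by (intro word_matrix_schottky_cone) (auto simp: l_def)
    then show "3 * \<bar>b \<bullet> (m *v v t)\<bar> \<le> \<bar>a \<bullet> (m *v v t)\<bar>" "\<bar>a \<bullet> (m *v v t)\<bar> \<ge> 3 * d"
      using av ab by (auto simp: schottky_cone_def a_def[symmetric] b_def[symmetric])
  qed
  define r where "r t = (b \<bullet> (m *v v t)) / (a \<bullet> (m *v v t))" for t
  have nz: "a \<bullet> (m *v v t) \<noteq> 0" if "\<bar>t\<bar> \<le> 1/3" for t using key(2)[OF that] ab by auto
  have "continuous_on {-1/3..1/3} (\<lambda>t. r t - t)"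
    unfolding r_def v_def using nz unfolding v_def
    by (auto intro!: continuous_intros simp: matrix_vector_right_distrib matrix_vector_mult_scaleR)
  moreover have rb: "\<bar>r t\<bar> \<le> 1/3" if "\<bar>t\<bar> \<le> 1/3" for t
    using key(1)[OF that] nz[OF that] by (simp add: r_def abs_divide field_simps)
  have "r (1/3) - 1/3 \<le> 0" "0 \<le> r (-1/3) - (-1/3)" using rb[of "1/3"] rb[of "-1/3"] by auto
  ultimately obtain t where t: "-1/3 \<le> t" "t \<le> 1/3" "r t - t = 0"
    using IVT2'[of "\<lambda>t. r t - t" "1/3" 0 "-1/3"] by auto
  then have t3: "\<bar>t\<bar> \<le> 1/3" by auto
  define c where "c = (a \<bullet> (m *v v t)) / d"
  have "b \<bullet> (m *v v t) = t * (a \<bullet> (m *v v t))" using t(3) nz[OF t3] by (simp add: r_def field_simps)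
  then have "d *\<^sub>R (m *v v t) = (a \<bullet> (m *v v t)) *\<^sub>R v t"
    using schottky_axis_span[of l "m *v v t"] by (simp add: d_def[symmetric] a_def[symmetric] b_def[symmetric] v_def algebra_simps)
  then have "m *v v t = c *\<^sub>R v t" using ab(2)
    by (metis c_def divide_inverse_commute less_irrefl real_vector_eq_affinity scaleR_scaleR
        vector_fraction_eq_iff)
  moreover have "v t \<noteq> 0" using av(1)[of t] ab(2) by auto
  moreover have dm: "det m = 1" by (simp add: m_def det_word_matrix)
  ultimately have "trace m = c + 1 / c" "c \<noteq> 0" using eigenvalue_trace by blast+
  moreover have c3: "\<bar>c\<bar> \<ge> 3" using key(2)[OF t3] ab(2) by (simp add: c_def abs_divide field_simps)
  then have "\<bar>1 / c\<bar> \<le> 1/3" by (simp add: abs_divide field_simps)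
  ultimately have "\<bar>trace m\<bar> > 2" using c3 by linarith
  with dm show ?thesis by (simp add: hyperbolic_def m_def)
qed

text \<open>
  Conjugation does not change the trace, so a word may be shortened by cancelling its first
  letter against its last one until it is cyclically reduced.
\<close>

theorem hyperbolic_word_matrix:
  assumes "w \<in> reduced_words {0,1}" "w \<noteq> []"
  shows "hyperbolic (word_matrix w)"
proof -
  have "freely_reduced w" "fst ` set w \<subseteq> {0,1}" using assms by (auto simp: reduced_words_def)
  then show ?thesis using assms(2)
  proof (induction w rule: length_induct)
    case (1 w)
    show ?case
    proof (cases "last w = letter_inv (hd w)")
      case False
      then show ?thesis using 1 by (intro hyperbolic_cyclically_reduced) auto
    next
      case True
      then have "tl w \<noteq> []" using 1 by (cases w) (auto simp: letter_inv_neq[symmetric])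
      then obtain v where w: "w = hd w # v @ [letter_inv (hd w)]"
        using True by (metis append_butlast_last_id last_tl list.collapse tl_Nil)
      define l where "l = hd w"
      have w': "w = l # v @ [letter_inv l]" using w by (simp add: l_def)
      have v: "v \<noteq> []" using 1(2) w' by (auto simp: freely_reduced_Cons)
      have "freely_reduced v" using 1(2) w'
        by (auto simp: freely_reduced_def successively_Cons successively_append_iff)
      moreover have "fst ` set v \<subseteq> {0,1}" using 1(3) w' by auto
      moreover have "length v < length w" using w' by simp
      ultimately have "hyperbolic (word_matrix v)" using 1(1) v by blast
      moreover have "trace (word_matrix w) = trace (word_matrix v)"
      proof -
        have "trace (word_matrix w) = trace ((letter_matrix l ** word_matrix v) ** letter_matrix (letter_inv l))"
          by (simp add: w' word_matrix_append matrix_mul_assoc)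
        also have "\<dots> = trace (letter_matrix (letter_inv l) ** (letter_matrix l ** word_matrix v))"
          by (rule trace_mul_sym)
        also have "letter_matrix (letter_inv l) ** (letter_matrix l ** word_matrix v) = word_matrix v"
          using letter_matrix_inv[of "letter_inv l"] by (simp add: matrix_mul_assoc)
        finally show ?thesis .
      qed
      ultimately show ?thesis by (simp add: hyperbolic_def det_word_matrix)
    qed
  qed
qed

section \<open>Conjugation, powers and unions of subgroups\<close>

context group
begin

definition conj_by :: "'a \<Rightarrow> 'a \<Rightarrow> 'a" where
  "conj_by g x = g \<otimes> x \<otimes> inv g"

lemma conj_by_closed [simp, intro]: "g \<in> carrier G \<Longrightarrow> x \<in> carrier G \<Longrightarrow> conj_by g x \<in> carrier G"
  by (simp add: conj_by_def)

lemma conj_by_mult: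
  assumes "g \<in> carrier G" "x \<in> carrier G" "y \<in> carrier G"
  shows "conj_by g (x \<otimes> y) = conj_by g x \<otimes> conj_by g y"
proof -
  have "inv g \<otimes> (g \<otimes> (y \<otimes> inv g)) = y \<otimes> inv g"
    using assms by (simp add: m_assoc[symmetric])
  then show ?thesis using assms by (simp add: conj_by_def m_assoc)
qed

lemma conj_by_one [simp]: "g \<in> carrier G \<Longrightarrow> conj_by g \<one> = \<one>"
  by (simp add: conj_by_def)

lemma conj_by_conj_by:
  "g \<in> carrier G \<Longrightarrow> h \<in> carrier G \<Longrightarrow> x \<in> carrier G \<Longrightarrow> conj_by g (conj_by h x) = conj_by (g \<otimes> h) x"
  by (simp add: conj_by_def m_assoc inv_mult_group)

lemma one_conj_by [simp]: "x \<in> carrier G \<Longrightarrow> conj_by \<one> x = x"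
  by (simp add: conj_by_def)

lemma conj_by_inv: "g \<in> carrier G \<Longrightarrow> x \<in> carrier G \<Longrightarrow> conj_by g (inv x) = inv (conj_by g x)"
  by (simp add: conj_by_def m_assoc inv_mult_group)

lemma conj_by_pow: "g \<in> carrier G \<Longrightarrow> x \<in> carrier G \<Longrightarrow> conj_by g (x [^] (n::nat)) = conj_by g x [^] n"
  by (induction n) (simp_all add: conj_by_mult)

definition power_product :: "nat \<Rightarrow> 'a list \<Rightarrow> 'a" where
  "power_product n rs = foldr (\<lambda>r x. r [^] n \<otimes> x) rs \<one>"

lemma power_product_simps [simp]:
  "power_product n [] = \<one>" "power_product n (r # rs) = r [^] n \<otimes> power_product n rs"
  by (simp_all add: power_product_def)

lemma subgroup_nat_pow_closed: "subgroup C G \<Longrightarrow> x \<in> C \<Longrightarrow> x [^] (n::nat) \<in> C"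
  by (induction n) (auto simp: subgroup.one_closed subgroup.m_closed)

text \<open>
  Induction on the number of subgroups. If \<open>x\<close> avoids all but \<open>C\<close>, and \<open>y\<close> avoids \<open>C\<close>, consider the
  elements \<open>y x\<^sup>k\<close>. None of them lies in \<open>C\<close> because \<open>x\<close> does. If infinitely many of them lay in
  the other subgroups, two would lie in the same one, hence so would a power of \<open>x\<close> and,
  by root-closedness, \<open>x\<close> itself.
\<close>

lemma avoid_root_closed_subgroups:
  assumes "subgroup D G" "finite F"
    and "\<And>C. C \<in> F \<Longrightarrow> subgroup C G"
    and "\<And>C. C \<in> F \<Longrightarrow> \<not> D \<subseteq> C"
    and "\<And>C x k. C \<in> F \<Longrightarrow> x \<in> D \<Longrightarrow> k > 0 \<Longrightarrow> x [^] (k::nat) \<in> C \<Longrightarrow> x \<in> C"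
  shows "\<exists>x\<in>D. \<forall>C\<in>F. x \<notin> C"
  using assms(2-)
proof (induction F)
  case empty
  then show ?case using subgroup.one_closed[OF assms(1)] by blast
next
  case (insert C F)
  note D = subgroup.mem_carrier[OF assms(1)]
  obtain x where x: "x \<in> D" "\<forall>C\<in>F. x \<notin> C"
    using insert.IH insert.prems by (metis insertI2)
  obtain y where y: "y \<in> D" "y \<notin> C" using insert.prems(2) by blast
  show ?case
  proof (cases "x \<in> C")
    case False
    then show ?thesis using x by blast
  next
    case True
    have C: "subgroup C G" using insert.prems by blast
    have xk: "x [^] k \<in> D" for k :: nat
      using x(1) assms(1) by (simp add: subgroup_nat_pow_closed)
    have yx: "y \<otimes> x [^] k \<in> D" for k :: nat
      using xk y(1) assms(1) by (simp add: subgroup.m_closed)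
    have notC: "y \<otimes> x [^] k \<notin> C" for k :: nat
    proof
      assume a: "y \<otimes> x [^] k \<in> C"
      have "x [^] k \<in> C" using True C by (simp add: subgroup_nat_pow_closed)
      then have "(y \<otimes> x [^] k) \<otimes> inv (x [^] k) \<in> C"
        using a C by (simp add: subgroup.m_closed subgroup.m_inv_closed)
      then show False using y D x by (simp add: m_assoc)
    qed
    have "\<exists>k::nat. \<forall>C'\<in>F. y \<otimes> x [^] k \<notin> C'"
    proof (rule ccontr)
      assume "\<nexists>k::nat. \<forall>C'\<in>F. y \<otimes> x [^] k \<notin> C'"
      then obtain f where f: "\<And>k::nat. f k \<in> F \<and> y \<otimes> x [^] k \<in> f k" by metis
      then have "range f \<subseteq> F" by blast
      then have "\<not> inj f" using insert.hyps(1)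
        by (meson finite_imageD finite_subset infinite_UNIV_nat)
      then obtain i j where "f i = f j" "i < j"
        by (metis injI linorder_neqE_nat)
      then obtain C' k where C': "C' \<in> F" "y \<otimes> x [^] i \<in> C'" "y \<otimes> x [^] (i + k) \<in> C'" "k > 0"
        using f by (metis less_imp_add_positive)
      have s: "subgroup C' G" using C'(1) insert.prems by blast
      have "inv (y \<otimes> x [^] i) \<otimes> (y \<otimes> x [^] (i + k)) \<in> C'"
        using C' s by (simp add: subgroup.m_closed subgroup.m_inv_closed)
      moreover have "y \<otimes> x [^] (i + k) = (y \<otimes> x [^] i) \<otimes> x [^] k"
        using D x y by (simp add: nat_pow_mult[symmetric] m_assoc)
      moreover have "inv g \<otimes> (g \<otimes> h) = h" if "g \<in> carrier G" "h \<in> carrier G" for g h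
        using that by (simp add: m_assoc[symmetric])
      ultimately have "x [^] k \<in> C'"
        using D x y by simp
      then show False using insert.prems(3) C' x by blast
    qed
    then show ?thesis using notC yx by blast
  qed
qed

end

section \<open>Groups acting through hyperbolic matrices\<close>

text \<open>
  All arguments concern the image of \<open>\<theta>\<close>, and \<open>comm\<close> below is commutation in this image.
\<close>

locale purely_hyperbolic = group G for G (structure) +
  fixes H and \<theta> :: "'a \<Rightarrow> real^2^2"
  assumes subgroup_H: "subgroup H G"
    and \<theta>_mult: "x \<in> H \<Longrightarrow> y \<in> H \<Longrightarrow> \<theta> (x \<otimes> y) = \<theta> x ** \<theta> y"
    and \<theta>_cases: "x \<in> H \<Longrightarrow> \<theta> x = mat 1 \<or> hyperbolic (\<theta> x)"
begin

definition comm :: "'a \<Rightarrow> 'a \<Rightarrow> bool" where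
  "comm x y \<longleftrightarrow> \<theta> x ** \<theta> y = \<theta> y ** \<theta> x"

lemmas H_closed [simp, intro] = subgroup.m_closed[OF subgroup_H] subgroup.m_inv_closed[OF subgroup_H]
  subgroup.one_closed[OF subgroup_H] subgroup.mem_carrier[OF subgroup_H]

lemma H_pow_closed [simp, intro]: "x \<in> H \<Longrightarrow> x [^] (n::nat) \<in> H"
  by (induction n) auto

lemma conj_by_H_closed [simp, intro]: "x \<in> H \<Longrightarrow> y \<in> H \<Longrightarrow> conj_by x y \<in> H"
  by (simp add: conj_by_def)

lemma det_\<theta>: "x \<in> H \<Longrightarrow> det (\<theta> x) = 1"
  using \<theta>_cases[of x] by (auto simp: hyperbolic_def)

lemma \<theta>_one [simp]: "\<theta> \<one> = mat 1"
proof -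
  have "invertible (\<theta> \<one>)" using det_\<theta>[of \<one>] by (simp add: invertible_det_nz)
  then obtain B where B: "B ** \<theta> \<one> = mat 1" by (auto simp: invertible_def)
  have "\<theta> \<one> = \<theta> \<one> ** \<theta> \<one>" using \<theta>_mult[of \<one> \<one>] by simp
  then have "B ** \<theta> \<one> = B ** (\<theta> \<one> ** \<theta> \<one>)" by simp
  then show ?thesis by (simp add: matrix_mul_assoc B)
qed

lemma \<theta>_inv: "x \<in> H \<Longrightarrow> \<theta> x ** \<theta> (inv x) = mat 1" "x \<in> H \<Longrightarrow> \<theta> (inv x) ** \<theta> x = mat 1"
  using \<theta>_mult[of x "inv x"] \<theta>_mult[of "inv x" x] by auto

lemma comm_sym: "comm x y \<Longrightarrow> comm y x"
  by (simp add: comm_def)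

lemma comm_refl [simp]: "comm x x"
  by (simp add: comm_def)

lemma comm_trivial: "\<theta> x = mat 1 \<Longrightarrow> comm x y"
  by (simp add: comm_def)

lemma comm_mult:
  assumes "x \<in> H" "y \<in> H" "comm x z" "comm y z"
  shows "comm (x \<otimes> y) z"
proof -
  have "\<theta> (x \<otimes> y) ** \<theta> z = \<theta> x ** (\<theta> y ** \<theta> z)"
    using assms by (simp add: \<theta>_mult matrix_mul_assoc)
  also have "\<dots> = \<theta> x ** \<theta> z ** \<theta> y"
    using assms by (simp add: comm_def matrix_mul_assoc)
  also have "\<dots> = \<theta> z ** \<theta> (x \<otimes> y)"
    using assms by (simp add: comm_def \<theta>_mult matrix_mul_assoc)
  finally show ?thesis by (simp add: comm_def)
qed

lemma comm_inv:
  assumes "x \<in> H" "comm x z"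
  shows "comm (inv x) z"
proof -
  have "\<theta> (inv x) ** \<theta> z = \<theta> (inv x) ** (\<theta> z ** \<theta> x) ** \<theta> (inv x)"
    using \<theta>_inv[OF assms(1)] by (simp add: matrix_mul_assoc[symmetric])
  also have "\<theta> z ** \<theta> x = \<theta> x ** \<theta> z" using assms by (simp add: comm_def)
  also have "\<theta> (inv x) ** (\<theta> x ** \<theta> z) ** \<theta> (inv x) = \<theta> z ** \<theta> (inv x)"
    using \<theta>_inv[OF assms(1)] by (simp add: matrix_mul_assoc)
  finally show ?thesis by (simp add: comm_def)
qed

lemma comm_inv_iff: "x \<in> H \<Longrightarrow> comm (inv x) z \<longleftrightarrow> comm x z"
  using comm_inv[of x z] comm_inv[of "inv x" z] by auto

lemma comm_pow: "x \<in> H \<Longrightarrow> comm x z \<Longrightarrow> comm (x [^] (n::nat)) z"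
  by (induction n) (auto simp: comm_trivial intro!: comm_mult)

text \<open>
  The commutator fixes the common eigenvector, so it is not hyperbolic and must be trivial.
\<close>

lemma comm_if_shared_eigenvector:
  assumes "x \<in> H" "y \<in> H" "v \<noteq> 0" "\<theta> x *v v = c *\<^sub>R v" "\<theta> y *v v = d *\<^sub>R v"
  shows "comm x y"
proof -
  define k where "k = x \<otimes> y \<otimes> inv (y \<otimes> x)"
  have k: "k \<in> H" using assms by (simp add: k_def)
  have "k \<otimes> (y \<otimes> x) = x \<otimes> y" using assms by (simp add: k_def m_assoc)
  then have eq: "\<theta> k ** (\<theta> y ** \<theta> x) = \<theta> x ** \<theta> y" using assms k
    by (metis \<theta>_mult H_closed(1))
  have "c \<noteq> 0" "d \<noteq> 0" using eigenvalue_trace(1) det_\<theta> assms by blast+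
  have "\<theta> k *v ((c * d) *\<^sub>R v) = (\<theta> k ** (\<theta> y ** \<theta> x)) *v v"
    using assms by (simp add: matrix_vector_mul_assoc[symmetric] matrix_vector_mult_scaleR mult.commute)
  also have "\<dots> = (c * d) *\<^sub>R v"
    unfolding eq using assms by (simp add: matrix_vector_mul_assoc[symmetric] matrix_vector_mult_scaleR mult.commute)
  finally have "(c * d) *\<^sub>R (\<theta> k *v v) = (c * d) *\<^sub>R v" by (simp add: matrix_vector_mult_scaleR)
  then have "\<theta> k *v v = v" using \<open>c \<noteq> 0\<close> \<open>d \<noteq> 0\<close> by simp
  then have "\<not> hyperbolic (\<theta> k)" using assms(3) by (rule not_hyperbolic_fixed_vector)
  then have "\<theta> k = mat 1" using \<theta>_cases k by blast
  then show ?thesis using eq by (simp add: comm_def)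
qed

lemma eigenvector_if_comm:
  assumes "x \<in> H" "\<theta> x \<noteq> mat 1" "comm x y" "v \<noteq> 0" "\<theta> x *v v = c *\<^sub>R v"
  obtains d where "\<theta> y *v v = d *\<^sub>R v"
proof -
  have "\<theta> x *v (\<theta> y *v v) = \<theta> y *v (\<theta> x *v v)"
    using assms(3) by (simp add: comm_def matrix_vector_mul_assoc)
  then have "\<theta> x *v (\<theta> y *v v) = c *\<^sub>R (\<theta> y *v v)" by (simp add: assms(5) matrix_vector_mult_scaleR)
  moreover have "hyperbolic (\<theta> x)" using assms \<theta>_cases by blast
  ultimately show ?thesis using that hyperbolic_eigenspace assms(4,5) by metis
qed

lemma nontrivial_eigenvector:
  assumes "x \<in> H" "\<theta> x \<noteq> mat 1"
  obtains c v where "\<bar>c\<bar> > 1" "trace (\<theta> x) = c + 1 / c" "v \<noteq> 0" "\<theta> x *v v = c *\<^sub>R v"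
proof -
  have "hyperbolic (\<theta> x)" using assms \<theta>_cases by blast
  then show ?thesis using that hyperbolic_eigenvector by metis
qed

text \<open>
  Everything that commutes with the nontrivial element \<open>y\<close> preserves its eigenlines.
\<close>

lemma comm_trans:
  assumes "x \<in> H" "y \<in> H" "z \<in> H" "\<theta> y \<noteq> mat 1" "comm x y" "comm y z"
  shows "comm x z"
proof -
  obtain c v where v: "v \<noteq> 0" "\<theta> y *v v = c *\<^sub>R v"
    using nontrivial_eigenvector[OF assms(2,4)] by blast
  obtain d where "\<theta> x *v v = d *\<^sub>R v"
    using eigenvector_if_comm[OF assms(2,4) comm_sym[OF assms(5)] v] .
  moreover obtain e where "\<theta> z *v v = e *\<^sub>R v"
    using eigenvector_if_comm[OF assms(2,4,6) v] .
  ultimately show ?thesis using comm_if_shared_eigenvector assms v(1) by blast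
qed

lemma \<theta>_pow_apply: "x \<in> H \<Longrightarrow> \<theta> (x [^] n) *v v = ((*v) (\<theta> x) ^^ n) v"
  by (induction n arbitrary: v)
     (simp_all add: \<theta>_mult matrix_vector_mul_assoc[symmetric] funpow_swap1)

lemma eigenvector_pow:
  assumes "x \<in> H" "\<theta> x *v v = c *\<^sub>R v"
  shows "\<theta> (x [^] (n::nat)) *v v = (c ^ n) *\<^sub>R v"
  by (induction n) (use assms in \<open>simp_all add: \<theta>_mult matrix_vector_mul_assoc[symmetric]
     matrix_vector_mult_scaleR mult.commute\<close>)

lemma pow_nontrivial:
  assumes "x \<in> H" "\<theta> x \<noteq> mat 1" "n > 0"
  shows "\<theta> (x [^] (n::nat)) \<noteq> mat 1"
proof
  assume t: "\<theta> (x [^] n) = mat 1"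
  obtain c v where v: "\<bar>c\<bar> > 1" "v \<noteq> 0" "\<theta> x *v v = c *\<^sub>R v"
    using nontrivial_eigenvector[OF assms(1,2)] by blast
  have "(c ^ n) *\<^sub>R v = v" using eigenvector_pow[OF assms(1) v(3), of n] t by simp
  then have "(c ^ n - 1) *\<^sub>R v = 0" by (simp add: algebra_simps)
  then have "c ^ n = 1" using v(2) by simp
  then have "\<bar>c\<bar> ^ n = 1" by (metis abs_one power_abs)
  then show False using v(1) assms(3) by (metis less_irrefl one_less_power)
qed

text \<open>
  This makes centralizers closed under roots: a nontrivial power of \<open>x\<close> commutes both with \<open>x\<close> and
  with \<open>y\<close>, so transitivity applies.
\<close>

lemma comm_pow_cancel:
  assumes "x \<in> H" "y \<in> H" "n > 0" "comm (x [^] (n::nat)) y"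
  shows "comm x y"
proof (cases "\<theta> x = mat 1")
  case False
  then show ?thesis using assms pow_nontrivial comm_trans[of x "x [^] n" y]
      comm_sym[OF comm_pow[OF assms(1) comm_refl]] by blast
qed (simp add: comm_trivial)

text \<open>
  If \<open>x\<close> commutes with its conjugate by \<open>y\<close>, then \<open>y\<close> maps eigenlines of \<open>x\<close> to eigenlines of \<open>x\<close>. As
  there are only two of them, among the three lines spanned by \<open>v\<close>, \<open>y v\<close> and \<open>y\<^sup>2 v\<close> two coincide,
  for an eigenvector \<open>v\<close> of \<open>x\<close>. Thus \<open>y\<close> or \<open>y\<^sup>2\<close> has an eigenvector in common with \<open>x\<close>.
\<close>

lemma comm_if_comm_conj_by:
  assumes "x \<in> H" "y \<in> H" "comm x (conj_by y x)"
  shows "comm x y"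
proof (cases "\<theta> x = mat 1")
  case False
  obtain c v where v: "\<bar>c\<bar> > 1" "trace (\<theta> x) = c + 1 / c" "v \<noteq> 0" "\<theta> x *v v = c *\<^sub>R v"
    using nontrivial_eigenvector[OF assms(1) False] by blast
  have cjy: "conj_by y x \<in> H" "conj_by y x \<otimes> y = y \<otimes> x" using assms by (auto simp: conj_by_def m_assoc)
  then have E: "\<theta> (conj_by y x) ** \<theta> y = \<theta> y ** \<theta> x" using assms by (metis \<theta>_mult)
  have nt: "\<theta> (conj_by y x) \<noteq> mat 1"
  proof
    assume "\<theta> (conj_by y x) = mat 1"
    then have "\<theta> (inv y) ** \<theta> y = \<theta> (inv y) ** (\<theta> y ** \<theta> x)" using E by simp
    then show False using False \<theta>_inv[OF assms(2)] by (simp add: matrix_mul_assoc)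
  qed
  have nz: "\<theta> y *v u \<noteq> 0" if "u \<noteq> 0" for u
  proof
    assume "\<theta> y *v u = 0"
    then have "(\<theta> (inv y) ** \<theta> y) *v u = 0" by (simp add: matrix_vector_mul_assoc[symmetric])
    then show False using that \<theta>_inv[OF assms(2)] by simp
  qed
  have step: "\<exists>d. \<theta> x *v (\<theta> y *v u) = d *\<^sub>R (\<theta> y *v u)" if u: "u \<noteq> 0" "\<theta> x *v u = k *\<^sub>R u" for u k
  proof -
    have "\<theta> (conj_by y x) *v (\<theta> y *v u) = k *\<^sub>R (\<theta> y *v u)"
      using u by (simp add: matrix_vector_mul_assoc E) (simp add: matrix_vector_mul_assoc[symmetric] matrix_vector_mult_scaleR)
    then show ?thesis using eigenvector_if_comm[OF cjy(1) nt comm_sym[OF assms(3)] nz[OF u(1)]] by metis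
  qed
  have ev: "d = c \<or> d = 1 / c" if "u \<noteq> 0" "\<theta> x *v u = d *\<^sub>R u" for u d
  proof -
    have "d \<noteq> 0" "c + 1 / c = d + 1 / d" using eigenvalue_trace[OF det_\<theta>[OF assms(1)] that(2,1)] v(2) by auto
    then have "(d - c) * (d - 1 / c) = 0" using v(1) by (simp add: field_simps)
    then show ?thesis by auto
  qed
  have hyp: "hyperbolic (\<theta> x)" using False \<theta>_cases assms by blast
  define u1 where "u1 = \<theta> y *v v"
  define u2 where "u2 = \<theta> y *v u1"
  have nz12: "u1 \<noteq> 0" "u2 \<noteq> 0" using nz v(3) by (auto simp: u1_def u2_def)
  obtain d1 where d1: "\<theta> x *v u1 = d1 *\<^sub>R u1" using step[OF v(3,4)] u1_def by blast
  obtain d2 where d2: "\<theta> x *v u2 = d2 *\<^sub>R u2" using step[OF nz12(1) d1] u2_def by blast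
  consider "d1 = c" | "d2 = d1" | "d2 = c" using ev[OF nz12(1) d1] ev[OF nz12(2) d2] by blast
  then show ?thesis
  proof cases
    case 1
    then obtain k where "u1 = k *\<^sub>R v" using hyperbolic_eigenspace[OF hyp v(4,3)] d1 by blast
    then show ?thesis using comm_if_shared_eigenvector[OF assms(1,2) v(3,4)] by (metis u1_def)
  next
    case 2
    then obtain k where "u2 = k *\<^sub>R u1" using hyperbolic_eigenspace[OF hyp d1 nz12(1)] d2 by blast
    then show ?thesis using comm_if_shared_eigenvector[OF assms(1,2) nz12(1) d1] by (metis u2_def)
  next
    case 3
    then obtain k where "u2 = k *\<^sub>R v" using hyperbolic_eigenspace[OF hyp v(4,3)] d2 by blast
    moreover have "\<theta> (y [^] (2::nat)) *v v = u2"
      using assms(2) by (simp add: \<theta>_mult matrix_vector_mul_assoc u2_def u1_def numeral_2_eq_2)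
    ultimately have "comm x (y [^] (2::nat))"
      using comm_if_shared_eigenvector[OF assms(1) _ v(3,4)] assms(2) by auto
    then show ?thesis using comm_pow_cancel[of y x 2] comm_sym assms by auto
  qed
qed (simp add: comm_trivial)

subsection \<open>Products of high powers\<close>

lemma power_product_closed [simp]: "set rs \<subseteq> H \<Longrightarrow> power_product n rs \<in> H"
  by (induction rs) auto

text \<open>
  Induction from the right. The rescaled product applied to a suitable vector converges to an
  eigenvector \<open>x\<close> of the first factor for its large eigenvalue. When a factor \<open>r\<close> is added in
  front, its powers rescale to a projection, and the limit vanishes only if \<open>x\<close> lies on the
  eigenline of \<open>r\<close> for the small eigenvalue. Then \<open>r\<close> would have an eigenvector in common with
  the next factor \<open>s\<close> and commute with it, and it cannot be equal to \<open>s\<close>, since \<open>x\<close> belongs to the large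
  eigenvalue of \<open>s\<close>.
\<close>

lemma power_product_growth:
  assumes "rs \<noteq> []" "set rs \<subseteq> H" "\<And>r. r \<in> set rs \<Longrightarrow> \<theta> r \<noteq> mat 1"
    and "successively (\<lambda>r s. r = s \<or> \<not> comm r s) rs"
  shows "\<exists>v q x c. \<bar>q\<bar> < 1 \<and> x \<noteq> 0 \<and> \<bar>c\<bar> > 1 \<and> \<theta> (hd rs) *v x = c *\<^sub>R x \<and>
           (\<lambda>n. q ^ n *\<^sub>R (\<theta> (power_product n rs) *v v)) \<longlonglongrightarrow> x"
  using assms
proof (induction rs)
  case (Cons r rs)
  have r: "r \<in> H" "\<theta> r \<noteq> mat 1" using Cons.prems by auto
  then have hyp: "hyperbolic (\<theta> r)" using \<theta>_cases by blast
  obtain d w where d: "\<bar>d\<bar> > 1" "trace (\<theta> r) = d + 1 / d" "w \<noteq> 0" "\<theta> r *v w = d *\<^sub>R w"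
    using nontrivial_eigenvector[OF r] by blast
  have d1: "\<bar>1 / d\<bar> < 1" using inverse_gap(1)[OF d(1)] .
  show ?case
  proof (cases "rs = []")
    case True
    have "(1 / d) ^ n *\<^sub>R (\<theta> (power_product n (r # rs)) *v w) = w" for n
    proof -
      have "(1 / d) ^ n * d ^ n = 1" using d(1) by (simp flip: power_mult_distrib)
      then show ?thesis using r by (simp add: True eigenvector_pow[OF r(1) d(4)])
    qed
    then have "(\<lambda>n. (1 / d) ^ n *\<^sub>R (\<theta> (power_product n (r # rs)) *v w)) \<longlonglongrightarrow> w" by simp
    then show ?thesis using d(1,3,4) d1
      by (intro exI[of _ w] exI[of _ "1 / d"] exI[of _ d]) simp
  next
    case False
    obtain s ss where rs: "rs = s # ss" using False by (cases rs) auto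
    obtain v q x c where IH: "\<bar>q\<bar> < 1" "x \<noteq> 0" "\<bar>c\<bar> > 1" "\<theta> s *v x = c *\<^sub>R x"
      "(\<lambda>n. q ^ n *\<^sub>R (\<theta> (power_product n rs) *v v)) \<longlonglongrightarrow> x"
      using Cons.IH Cons.prems False rs by (auto simp: successively_Cons)
    define P where "P = (\<lambda>y. (1 / (d - 1 / d)) *\<^sub>R (\<theta> r *v y - (1 / d) *\<^sub>R y))"
    have lim: "(\<lambda>n. (1 / d) ^ n *\<^sub>R (((*v) (\<theta> r) ^^ n) (q ^ n *\<^sub>R (\<theta> (power_product n rs) *v v)))) \<longlonglongrightarrow> P x"
      and eig: "\<theta> r *v P x = d *\<^sub>R P x"
      unfolding P_def by (rule hyperbolic_powers_limit[OF hyp d(1,2) IH(5)])+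
    have "(1 / d) ^ n *\<^sub>R (((*v) (\<theta> r) ^^ n) (q ^ n *\<^sub>R (\<theta> (power_product n rs) *v v)))
      = (q / d) ^ n *\<^sub>R (\<theta> (power_product n (r # rs)) *v v)" for n
    proof -
      have "set rs \<subseteq> H" using Cons.prems by simp
      then show ?thesis using r(1)
        by (simp add: \<theta>_mult matrix_vector_mul_assoc[symmetric] \<theta>_pow_apply[symmetric]
            matrix_vector_mult_scaleR power_divide)
    qed
    then have "(\<lambda>n. (q / d) ^ n *\<^sub>R (\<theta> (power_product n (r # rs)) *v v)) \<longlonglongrightarrow> P x"
      using lim by simp
    moreover have "\<bar>q / d\<bar> < 1" using IH(1) d(1) by (simp add: abs_divide field_simps)
    moreover have "P x \<noteq> 0"
    proof
      assume "P x = 0"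
      then have rx: "\<theta> r *v x = (1 / d) *\<^sub>R x"
        using inverse_gap(2)[OF d(1)] by (simp add: P_def)
      have "r = s \<or> \<not> comm r s" using Cons.prems rs by simp
      moreover have "comm r s" using comm_if_shared_eigenvector[OF r(1) _ IH(2) rx IH(4)] Cons.prems rs by simp
      ultimately have "c *\<^sub>R x = (1 / d) *\<^sub>R x" using rx IH(4) by simp
      then have "c = 1 / d" using IH(2) by (metis scaleR_right_imp_eq)
      then show False using IH(3) d1 by simp
    qed
    ultimately show ?thesis using eig d(1)
      by (intro exI[of _ v] exI[of _ "q / d"] exI[of _ "P x"] exI[of _ d]) simp
  qed
qed simp

text \<open>
  After rescaling, the product has a nonzero limit on some vector, while a fixed matrix
  tends to zero. Equal neighbours are allowed so that words in the letters \<open>a\<^sup>M\<close> and \<open>b\<^sup>M\<close> are covered.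
\<close>

theorem power_product_eventually_neq:
  assumes "rs \<noteq> []" "set rs \<subseteq> H" "\<And>r. r \<in> set rs \<Longrightarrow> \<theta> r \<noteq> mat 1"
    and "successively (\<lambda>r s. r = s \<or> \<not> comm r s) rs"
  shows "\<forall>\<^sub>F n in sequentially. \<theta> (power_product n rs) \<noteq> m"
proof -
  obtain v q x where *: "\<bar>q\<bar> < 1" "x \<noteq> 0"
    "(\<lambda>n. q ^ n *\<^sub>R (\<theta> (power_product n rs) *v v)) \<longlonglongrightarrow> x"
    using power_product_growth[OF assms] by blast
  have "(\<lambda>n. q ^ n) \<longlonglongrightarrow> 0" by (rule LIMSEQ_power_zero) (simp only: real_norm_def *(1))
  then have "(\<lambda>n. q ^ n *\<^sub>R (m *v v)) \<longlonglongrightarrow> 0 *\<^sub>R (m *v v)"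
    by (intro tendsto_scaleR tendsto_const)
  then have "(\<lambda>n. q ^ n *\<^sub>R (\<theta> (power_product n rs) *v v) - q ^ n *\<^sub>R (m *v v)) \<longlonglongrightarrow> x - 0 *\<^sub>R (m *v v)"
    by (intro tendsto_diff *(3))
  then have "\<forall>\<^sub>F n in sequentially. q ^ n *\<^sub>R (\<theta> (power_product n rs) *v v) - q ^ n *\<^sub>R (m *v v) \<noteq> 0"
    using *(2) by (intro tendsto_imp_eventually_ne[of _ x]) simp_all
  then show ?thesis by (rule eventually_mono) auto
qed

subsection \<open>The normal core\<close>

text \<open>
  The largest normal subgroup of \<open>G\<close> inside \<open>H\<close>: for its elements, \<open>\<theta>\<close> can be applied to all conjugates.
\<close>

definition core :: "'a set" where
  "core = {x \<in> carrier G. \<forall>g\<in>carrier G. conj_by g x \<in> H}"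

lemma conj_by_core_H: "g \<in> carrier G \<Longrightarrow> x \<in> core \<Longrightarrow> conj_by g x \<in> H"
  by (simp add: core_def)

lemma core_carrier: "x \<in> core \<Longrightarrow> x \<in> carrier G"
  by (simp add: core_def)

lemma subgroup_core: "subgroup core G"
  by (rule subgroupI) (auto simp: core_def conj_by_mult conj_by_inv)

lemma comm_conj_by_cancel:
  assumes "h \<in> H" "x \<in> H" "y \<in> H" "comm (conj_by h x) (conj_by h y)"
  shows "comm x y"
proof -
  have "\<theta> (conj_by h (x \<otimes> y)) = \<theta> (conj_by h (y \<otimes> x))"
    using assms by (simp add: conj_by_mult \<theta>_mult comm_def)
  then have "\<theta> h ** \<theta> (x \<otimes> y) ** \<theta> (inv h) = \<theta> h ** \<theta> (y \<otimes> x) ** \<theta> (inv h)"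
    using assms(1-3) by (simp add: conj_by_def \<theta>_mult)
  then have "\<theta> (inv h) ** (\<theta> h ** \<theta> (x \<otimes> y) ** \<theta> (inv h)) ** \<theta> h
      = \<theta> (inv h) ** (\<theta> h ** \<theta> (y \<otimes> x) ** \<theta> (inv h)) ** \<theta> h"
    by simp
  then have "\<theta> (inv h) ** \<theta> h ** \<theta> (x \<otimes> y) ** (\<theta> (inv h) ** \<theta> h)
      = \<theta> (inv h) ** \<theta> h ** \<theta> (y \<otimes> x) ** (\<theta> (inv h) ** \<theta> h)"
    by (simp only: matrix_mul_assoc)
  then show ?thesis using assms by (simp add: \<theta>_inv comm_def \<theta>_mult)
qed

text \<open>
  For \<open>(g, e)\<close> in \<open>P\<close>, the \<open>x\<close> with \<open>\<theta> (g x g\<inverse>)\<close> commuting with \<open>\<theta> e\<close> form a root-closed subgroup. It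
  does not contain \<open>D\<close>: otherwise, by transitivity through \<open>e\<close>, the conjugate of \<open>D\<close> by \<open>g\<close> would have a
  commutative image.
\<close>

lemma avoid_commuting:
  assumes D: "subgroup D G" "D \<subseteq> core" and P: "finite P" "P \<subseteq> carrier G \<times> H"
    and nontrivial: "\<And>g e. (g, e) \<in> P \<Longrightarrow> \<theta> e \<noteq> mat 1"
    and nonabelian: "\<And>g. g \<in> carrier G \<Longrightarrow> \<exists>a\<in>D. \<exists>b\<in>D. \<not> comm (conj_by g a) (conj_by g b)"
  shows "\<exists>z\<in>D. \<forall>(g, e)\<in>P. \<not> comm (conj_by g z) e"
proof -
  define C where "C = (\<lambda>(g, e). {x \<in> core. comm (conj_by g x) e})"
  have "\<exists>z\<in>D. \<forall>A\<in>C ` P. z \<notin> A"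
  proof (rule avoid_root_closed_subgroups[OF D(1)])
    show "finite (C ` P)" using P by simp
  next
    fix A assume "A \<in> C ` P"
    then obtain g e where ge: "g \<in> carrier G" "e \<in> H" "A = C (g, e)" using P by auto
    show "subgroup A G"
    proof (rule subgroupI)
      show "A \<subseteq> carrier G" using ge core_carrier by (auto simp: C_def)
      show "A \<noteq> {}" using ge subgroup.one_closed[OF subgroup_core] by (auto simp: C_def comm_trivial)
      fix a assume a: "a \<in> A"
      then show "inv a \<in> A" using ge subgroup.m_inv_closed[OF subgroup_core]
        by (auto simp: C_def conj_by_inv core_carrier intro!: comm_inv conj_by_core_H)
      fix b assume "b \<in> A"
      then show "a \<otimes> b \<in> A" using a ge subgroup.m_closed[OF subgroup_core]
        by (auto simp: C_def conj_by_mult core_carrier intro!: comm_mult conj_by_core_H)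
    qed
  next
    fix A assume "A \<in> C ` P"
    then obtain g e where ge: "g \<in> carrier G" "e \<in> H" "A = C (g, e)" "\<theta> e \<noteq> mat 1"
      using P nontrivial by auto
    obtain a b where ab: "a \<in> D" "b \<in> D" "\<not> comm (conj_by g a) (conj_by g b)" using nonabelian[OF ge(1)] by blast
    show "\<not> D \<subseteq> A"
    proof
      assume "D \<subseteq> A"
      then have "comm (conj_by g a) e" "comm e (conj_by g b)" using ab ge by (auto simp: C_def comm_sym)
      then show False using comm_trans ab ge conj_by_core_H D by blast
    qed
  next
    fix A x and k :: nat assume A: "A \<in> C ` P" and x: "x \<in> D" "k > 0" "x [^] k \<in> A"
    then obtain g e where ge: "g \<in> carrier G" "e \<in> H" "A = C (g, e)" using P by auto
    have "x \<in> core" using x D by blast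
    then show "x \<in> A" using x ge comm_pow_cancel[of "conj_by g x" e k] conj_by_core_H
      by (auto simp: C_def conj_by_pow core_carrier)
  qed
  then show ?thesis using D(2) by (fastforce simp: C_def)
qed

end

section \<open>Noncommuting elements of the core\<close>

text \<open>
  For a large group, \<open>\<theta>\<close> is the surjection onto the free group followed by its Schottky
  representation.
\<close>

locale large_action = purely_hyperbolic +
  assumes finite_index: "finite (rcosets H)"
    and nonabelian: "\<exists>a\<in>H. \<exists>b\<in>H. \<not> comm a b"
begin

text \<open>
  By the pigeonhole principle some \<open>x\<^sup>k\<close> with \<open>k\<close> at most the index lies in \<open>H\<close>, and \<open>k\<close> divides the
  factorial of the index. The exponent does not depend on \<open>x\<close>, so it also serves all conjugates of \<open>x\<close>
  and thereby yields elements of the core.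
\<close>

lemma power_in_H:
  assumes x: "x \<in> carrier G"
  shows "x [^] (fact (card (rcosets H)) :: nat) \<in> H"
proof -
  let ?d = "card (rcosets H)"
  have r: "(\<lambda>i::nat. H #> x [^] i) ` {..?d} \<subseteq> rcosets H"
    using x subgroup.subset[OF subgroup_H] by (auto intro: rcosetsI)
  have "\<not> inj_on (\<lambda>i::nat. H #> x [^] i) {..?d}"
  proof
    assume "inj_on (\<lambda>i::nat. H #> x [^] i) {..?d}"
    then have "card {..?d} \<le> ?d" using card_inj_on_le[OF _ r finite_index] by blast
    then show False by simp
  qed
  then obtain i j :: nat where ij: "i < j" "j \<le> ?d" "H #> x [^] i = H #> x [^] j"
    unfolding inj_on_def by (metis atMost_iff linorder_neqE_nat)
  obtain k where k: "j = i + k" "k > 0" using ij(1) less_imp_add_positive by blast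
  have "x [^] j \<in> H #> x [^] i" using x rcos_self[OF _ subgroup_H, of "x [^] j"] ij(3) by simp
  then obtain h where h: "h \<in> H" "x [^] j = h \<otimes> x [^] i" by (auto simp: r_coset_def)
  have "x [^] j = x [^] k \<otimes> x [^] i" using x k by (simp add: nat_pow_mult add.commute)
  then have "x [^] k = h" using h x by (simp add: H_closed(4))
  then have "x [^] k \<in> H" using h by simp
  moreover have "k dvd fact ?d" using k ij by (intro dvd_fact) auto
  ultimately show ?thesis using x by (metis H_pow_closed dvd_def nat_pow_pow)
qed

lemma power_in_core:
  assumes x: "x \<in> carrier G"
  shows "x [^] (fact (card (rcosets H)) :: nat) \<in> core"
  using assms power_in_H by (simp add: core_def conj_by_pow)

text \<open>
  Conjugating back by \<open>g\<close> reduces this to powers of two noncommuting elements of \<open>H\<close>, which do not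
  commute by root-closedness of centralizers.
\<close>

lemma core_nonabelian:
  assumes g: "g \<in> carrier G"
  shows "\<exists>a\<in>core. \<exists>b\<in>core. \<not> comm (conj_by g a) (conj_by g b)"
proof -
  let ?m = "fact (card (rcosets H)) :: nat"
  obtain a b where ab: "a \<in> H" "b \<in> H" "\<not> comm a b" using nonabelian by blast
  have "conj_by g (conj_by (inv g) a [^] ?m) = a [^] ?m" "conj_by g (conj_by (inv g) b [^] ?m) = b [^] ?m"
    using g ab by (simp_all add: conj_by_pow conj_by_conj_by H_closed(4))
  moreover have "\<not> comm (a [^] ?m) (b [^] ?m)"
    using ab comm_pow_cancel[of a _ ?m] comm_pow_cancel[of b a ?m] comm_sym by (meson H_pow_closed fact_gt_zero)
  ultimately show ?thesis using power_in_core g ab by (metis conj_by_closed inv_closed H_closed(4))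
qed

lemma finite_transversal:
  obtains T where "finite T" "T \<subseteq> carrier G" "\<And>g. g \<in> carrier G \<Longrightarrow> \<exists>t\<in>T. \<exists>h\<in>H. g = h \<otimes> t"
proof -
  define T where "T = (\<lambda>A. SOME x. x \<in> A) ` (rcosets H)"
  have mem: "(SOME x. x \<in> H #> g) \<in> H #> g" if "g \<in> carrier G" for g
    using rcos_self[OF that subgroup_H] by (rule someI)
  have "T \<subseteq> carrier G"
    using mem r_coset_subset_G[OF subgroup.subset[OF subgroup_H]] by (auto simp: T_def RCOSETS_def)
  moreover have "\<exists>t\<in>T. \<exists>h\<in>H. g = h \<otimes> t" if g: "g \<in> carrier G" for g
  proof -
    define t where "t = (SOME x. x \<in> H #> g)"
    have "t \<in> T" using g by (auto simp: T_def t_def RCOSETS_def)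
    moreover obtain h where "h \<in> H" "t = h \<otimes> g" using mem[OF g] by (auto simp: t_def r_coset_def)
    moreover from this have "g = inv h \<otimes> t" using g by (simp add: m_assoc[symmetric] H_closed(4))
    ultimately show ?thesis by blast
  qed
  ultimately show ?thesis using that[of T] finite_index by (simp add: T_def)
qed

text \<open>
  The difficulty is to serve all \<open>g\<close> with one pair. Changing \<open>g\<close> by an element of \<open>H\<close> on the left
  conjugates both images simultaneously, so only a finite transversal of \<open>H\<close> matters, and
  \<open>avoid_commuting\<close> yields \<open>a\<close> with nontrivial image in each of these conjugates, then \<open>b\<close>.
\<close>

lemma noncommuting_pair:
  obtains a b where "a \<in> core" "b \<in> core" "\<And>g. g \<in> carrier G \<Longrightarrow> \<not> comm (conj_by g a) (conj_by g b)"
proof -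
  obtain T where T: "finite T" "T \<subseteq> carrier G" "\<And>g. g \<in> carrier G \<Longrightarrow> \<exists>t\<in>T. \<exists>h\<in>H. g = h \<otimes> t"
    using finite_transversal by metis
  obtain e where e: "e \<in> H" "\<theta> e \<noteq> mat 1" using nonabelian comm_trivial by blast
  have "\<exists>z\<in>core. \<forall>(g, e)\<in>(\<lambda>t. (t, e)) ` T. \<not> comm (conj_by g z) e"
    by (rule avoid_commuting[OF subgroup_core subset_refl]) (use T e core_nonabelian in auto)
  then obtain a where a: "a \<in> core" "\<And>t. t \<in> T \<Longrightarrow> \<not> comm (conj_by t a) e" by auto
  have nt: "\<theta> (conj_by t a) \<noteq> mat 1" if "t \<in> T" for t using a(2)[OF that] comm_trivial by blast
  have "\<exists>z\<in>core. \<forall>(g, e)\<in>(\<lambda>t. (t, conj_by t a)) ` T. \<not> comm (conj_by g z) e"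
    by (rule avoid_commuting[OF subgroup_core subset_refl]) (use T a nt core_nonabelian conj_by_core_H in auto)
  then obtain b where b: "b \<in> core" "\<And>t. t \<in> T \<Longrightarrow> \<not> comm (conj_by t b) (conj_by t a)" by auto
  have "\<not> comm (conj_by g a) (conj_by g b)" if g: "g \<in> carrier G" for g
  proof
    assume c: "comm (conj_by g a) (conj_by g b)"
    obtain t h where th: "t \<in> T" "h \<in> H" "g = h \<otimes> t" using T(3)[OF g] by blast
    have t: "t \<in> carrier G" using th T by blast
    have "comm (conj_by h (conj_by t a)) (conj_by h (conj_by t b))"
      using c th t a b by (simp add: conj_by_conj_by core_carrier H_closed(4))
    then have "comm (conj_by t a) (conj_by t b)" using comm_conj_by_cancel th t a(1) b(1) conj_by_core_H by blast
    then show False using b(2)[OF th(1)] comm_sym by blast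
  qed
  then show ?thesis using that a(1) b(1) by blast
qed

end

section \<open>Short relations among tuples\<close>

context group
begin

definition letter_value :: "('i \<Rightarrow> 'a) \<Rightarrow> 'i \<times> bool \<Rightarrow> 'a" where
  "letter_value x l = (if snd l then x (fst l) else inv (x (fst l)))"

text \<open>
  Words are indexed by positions in a tuple and not by group elements, so that one word can be evaluated
  at several tuples.
\<close>

definition tuple_eval :: "('i \<Rightarrow> 'a) \<Rightarrow> ('i \<times> bool) list \<Rightarrow> 'a" where
  "tuple_eval x w = eval_word G (map (map_prod x id) w)"

lemma tuple_eval_simps [simp]:
  "tuple_eval x [] = \<one>"
  "tuple_eval x (l # w) = letter_value x l \<otimes> tuple_eval x w"
  by (simp_all add: tuple_eval_def eval_word_def letter_value_def eval_letter_def)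

lemma letter_value_mem:
  "subgroup D G \<Longrightarrow> x (fst l) \<in> D \<Longrightarrow> letter_value x l \<in> D"
  by (simp add: letter_value_def subgroup.m_inv_closed)

lemma tuple_eval_mem:
  "subgroup D G \<Longrightarrow> (\<And>l. l \<in> set w \<Longrightarrow> x (fst l) \<in> D) \<Longrightarrow> tuple_eval x w \<in> D"
  by (induction w) (auto simp: subgroup.one_closed intro!: subgroup.m_closed letter_value_mem)

lemma letter_value_closed [simp]:
  "(\<And>i. x i \<in> carrier G) \<Longrightarrow> letter_value x l \<in> carrier G"
  by (simp add: letter_value_def)

lemma tuple_eval_closed [simp]:
  "(\<And>i. x i \<in> carrier G) \<Longrightarrow> tuple_eval x w \<in> carrier G"
  by (induction w) auto

lemma tuple_eval_append:
  "(\<And>i. x i \<in> carrier G) \<Longrightarrow> tuple_eval x (v @ w) = tuple_eval x v \<otimes> tuple_eval x w"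
  by (induction v) (auto simp: m_assoc)

lemma tuple_eval_cong:
  "(\<And>l. l \<in> set w \<Longrightarrow> x (fst l) = y (fst l)) \<Longrightarrow> tuple_eval x w = tuple_eval y w"
  by (induction w) (auto simp: letter_value_def)

text \<open>
  Two equal entries would give a relation of length 2.
\<close>

lemma inj_on_if_no_short_relation:
  assumes x: "x ` I \<subseteq> carrier G" and n: "2 \<le> n"
    and free: "\<And>w. w \<in> reduced_words I \<Longrightarrow> w \<noteq> [] \<Longrightarrow> length w \<le> n \<Longrightarrow> tuple_eval x w \<noteq> \<one>"
  shows "inj_on x I"
proof (rule inj_onI, rule ccontr)
  fix i j assume ij: "i \<in> I" "j \<in> I" "x i = x j" "i \<noteq> j"
  have "tuple_eval x [(i, True), (j, False)] = \<one>"
    using ij x by (auto simp: letter_value_def)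
  moreover have "[(i, True), (j, False)] \<in> reduced_words I"
    using ij by (simp add: reduced_words_def freely_reduced_Cons letter_inv_def)
  ultimately show False using free[of "[(i, True), (j, False)]"] n by simp
qed

text \<open>
  As the tuple is injective, words over the set of its entries correspond to words over the index set,
  and reducedness is the same for both.
\<close>

lemma girth_wrt_image_ge:
  assumes x: "x ` I \<subseteq> carrier G" and n: "2 \<le> n"
    and free: "\<And>w. w \<in> reduced_words I \<Longrightarrow> w \<noteq> [] \<Longrightarrow> length w \<le> n \<Longrightarrow> tuple_eval x w \<noteq> \<one>"
  shows "enat n \<le> girth_wrt G (x ` I)"
  unfolding girth_wrt_def
proof (rule INF_greatest, clarify)
  fix w assume w: "w \<in> reduced_words (x ` I)" "w \<noteq> []" "eval_word G w = \<one>"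
  have inj: "inj_on x I" using inj_on_if_no_short_relation[OF x n free] .
  define u where "u = map (map_prod (inv_into I x) id) w"
  have w1: "w \<in> lists (x ` I \<times> UNIV)" "freely_reduced w"
    using w(1) by (auto simp: reduced_words_def)
  have xu: "map (map_prod x id) u = w"
  proof -
    have "map_prod x id (map_prod (inv_into I x) id l) = l" if "l \<in> set w" for l
      using that w1(1) by (cases l) (auto simp: f_inv_into_f)
    then show ?thesis by (simp add: u_def map_idI)
  qed
  have uI: "u \<in> lists (I \<times> UNIV)"
    using w1(1) by (fastforce simp: u_def inv_into_into)
  have "freely_reduced u"
    unfolding freely_reduced_def u_def successively_map
  proof (rule successively_mono[OF w1(2)[unfolded freely_reduced_def]])
    fix l k assume lk: "l \<in> set w" "k \<in> set w" "k \<noteq> letter_inv l"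
    have "inj_on (inv_into I x) (x ` I)" by (rule inj_on_inv_into) simp
    moreover have "fst k \<in> x ` I" "fst l \<in> x ` I" using lk w1(1) by auto
    ultimately have "inv_into I x (fst k) = inv_into I x (fst l) \<longleftrightarrow> fst k = fst l"
      by (rule inj_on_eq_iff)
    then show "map_prod (inv_into I x) id k \<noteq> letter_inv (map_prod (inv_into I x) id l)"
      using lk(3) by (simp add: letter_inv_def prod_eq_iff)
  qed
  with uI have "u \<in> reduced_words I" by (simp add: reduced_words_def)
  moreover have "u \<noteq> []" using w(2) by (simp add: u_def)
  moreover have "tuple_eval x u = \<one>" using w(3) xu by (simp add: tuple_eval_def)
  ultimately have "\<not> length u \<le> n" using free by blast
  then show "enat n \<le> enat (length w)" by (simp add: u_def)
qed

lemma finite_short_words: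
  assumes "finite I"
  shows "finite {w \<in> lists (I \<times> (UNIV :: bool set)). length w \<le> n}"
proof -
  have "{w \<in> lists (I \<times> UNIV). length w \<le> n} = {w. set w \<subseteq> I \<times> (UNIV :: bool set) \<and> length w \<le> n}"
    by auto
  then show ?thesis using assms by (simp only: finite_lists_length_le finite_cartesian_product finite)
qed

end

context large_action
begin

text \<open>
  The pair consists of high powers of the pair from \<open>noncommuting_pair\<close>. Evaluated at it, a reduced word
  is a product of powers whose neighbours are equal or do not commute. One exponent is large
  enough for the finitely many words and the finitely many elements of a transversal.
\<close>

lemma free_pair:
  fixes n :: nat
  obtains h :: "nat \<Rightarrow> 'a" where "\<And>i. h i \<in> core"
    and "\<And>g w. g \<in> carrier G \<Longrightarrow> w \<in> reduced_words {0,1} \<Longrightarrow> w \<noteq> [] \<Longrightarrow> length w \<le> n \<Longrightarrow>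
      \<theta> (conj_by g (tuple_eval h w)) \<noteq> mat 1"
proof -
  obtain a b where ab: "a \<in> core" "b \<in> core"
    "\<And>g. g \<in> carrier G \<Longrightarrow> \<not> comm (conj_by g a) (conj_by g b)"
    using noncommuting_pair by metis
  obtain T where T: "finite T" "T \<subseteq> carrier G" "\<And>g. g \<in> carrier G \<Longrightarrow> \<exists>t\<in>T. \<exists>h\<in>H. g = h \<otimes> t"
    using finite_transversal by metis
  define x where "x = (\<lambda>i::nat. if i = 0 then a else b)"
  define y where "y M = (\<lambda>i. x i [^] M)" for M :: nat
  define W where "W = {w \<in> reduced_words {0,1::nat}. w \<noteq> [] \<and> length w \<le> n}"
  have x: "x i \<in> core" "x i \<in> carrier G" for i using ab core_carrier by (auto simp: x_def)
  have y: "y M i \<in> core" "y M i \<in> carrier G" for M i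
    using x subgroup_nat_pow_closed[OF subgroup_core] by (auto simp: y_def)
  have xl: "letter_value x l \<in> core" for l using letter_value_mem[OF subgroup_core] x by blast
  have yl: "letter_value (y M) l = letter_value x l [^] M" for M l
    using x by (simp add: letter_value_def y_def nat_pow_inv)
  have yw: "tuple_eval (y M) w \<in> core" for M w using tuple_eval_mem[OF subgroup_core] y by blast
  have conj_by_eval: "conj_by g (tuple_eval (y M) w) = power_product M (map (\<lambda>l. conj_by g (letter_value x l)) w)"
    if "g \<in> carrier G" for g M w
    by (induction w) (use that x y in \<open>simp_all add: conj_by_mult conj_by_pow yl\<close>)
  have "finite W"
    by (rule finite_subset[OF _ finite_short_words[of "{0,1}" n]]) (auto simp: W_def reduced_words_def)
  have nc: "\<not> comm (conj_by g (letter_value x l)) (conj_by g (letter_value x k))"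
    if "g \<in> carrier G" "{fst l, fst k} = {0, 1}" for g l k
  proof -
    have "comm (conj_by g (letter_value x l)) z \<longleftrightarrow> comm (conj_by g (x (fst l))) z" for l z
      using that(1) x by (simp add: letter_value_def conj_by_inv comm_inv_iff conj_by_core_H)
    then have "comm (conj_by g (letter_value x l)) (conj_by g (letter_value x k)) \<longleftrightarrow> comm (conj_by g (x (fst l))) (conj_by g (x (fst k)))"
      using comm_sym by metis
    moreover have "\<not> comm (conj_by g b) (conj_by g a)" using ab(3)[OF that(1)] comm_sym by blast
    ultimately show ?thesis using that(2) ab(3)[OF that(1)] by (auto simp: x_def doubleton_eq_iff)
  qed
  have "\<forall>\<^sub>F M in sequentially. \<theta> (conj_by t (tuple_eval (y M) w)) \<noteq> mat 1" if "t \<in> T" "w \<in> W" for t w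
  proof -
    have t: "t \<in> carrier G" using that T by blast
    have w: "w \<noteq> []" "freely_reduced w" "fst ` set w \<subseteq> {0,1}"
      using that(2) by (auto simp: W_def reduced_words_def)
    define rs where "rs = map (\<lambda>l. conj_by t (letter_value x l)) w"
    have "\<forall>\<^sub>F M in sequentially. \<theta> (power_product M rs) \<noteq> mat 1"
    proof (rule power_product_eventually_neq)
      show "rs \<noteq> []" using w by (simp add: rs_def)
      show "set rs \<subseteq> H" using xl t by (auto simp: rs_def intro!: conj_by_core_H)
      show "\<theta> r \<noteq> mat 1" if r: "r \<in> set rs" for r
      proof -
        obtain l where l: "l \<in> set w" "r = conj_by t (letter_value x l)" using r by (auto simp: rs_def)
        \<comment> \<open>The letter of the other generator shows that the image of \<open>l\<close> is not central.\<close>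
        have "{fst l, fst (1 - fst l, True)} = {0, 1}" using w(3) l by auto
        then show ?thesis using nc[OF t, of l "(1 - fst l, True)"] l comm_trivial by auto
      qed
      show "successively (\<lambda>r s. r = s \<or> \<not> comm r s) rs"
        unfolding rs_def successively_map
      proof (rule successively_mono[OF w(2)[unfolded freely_reduced_def]])
        fix l k assume lk: "l \<in> set w" "k \<in> set w" "k \<noteq> letter_inv l"
        have "fst l \<in> {0, 1}" "fst k \<in> {0, 1}" using lk w(3) by blast+
        then have "l = k \<or> {fst l, fst k} = {0, 1}"
          using lk(3) by (auto simp: letter_inv_def prod_eq_iff)
        then show "conj_by t (letter_value x l) = conj_by t (letter_value x k) \<or>
            \<not> comm (conj_by t (letter_value x l)) (conj_by t (letter_value x k))"
          using nc[OF t] by blast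
      qed
    qed
    then show ?thesis by (simp add: conj_by_eval[OF t] rs_def)
  qed
  then have "\<forall>\<^sub>F M in sequentially. \<forall>t\<in>T. \<forall>w\<in>W. \<theta> (conj_by t (tuple_eval (y M) w)) \<noteq> mat 1"
    using T(1) \<open>finite W\<close> by (intro eventually_ball_finite ballI) auto
  then obtain M where M: "\<forall>t\<in>T. \<forall>w\<in>W. \<theta> (conj_by t (tuple_eval (y M) w)) \<noteq> mat 1"
    using eventually_happens'[OF sequentially_bot] by blast
  \<comment> \<open>Modulo \<open>H\<close>, every \<open>g\<close> is in the transversal. An element whose conjugate by \<open>h\<close> in \<open>H\<close> has trivial
    image commutes with everything, so it has trivial image itself.\<close>
  have "\<theta> (conj_by g (tuple_eval (y M) w)) \<noteq> mat 1" if g: "g \<in> carrier G" and w: "w \<in> W" for g w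
  proof
    assume a: "\<theta> (conj_by g (tuple_eval (y M) w)) = mat 1"
    obtain t h where th: "t \<in> T" "h \<in> H" "g = h \<otimes> t" using T(3)[OF g] by blast
    have t: "t \<in> carrier G" using th T by blast
    define c where "c = conj_by t (tuple_eval (y M) w)"
    have c: "c \<in> H" using yw t conj_by_core_H by (simp add: c_def)
    have "conj_by g (tuple_eval (y M) w) = conj_by h c"
      using th t yw core_carrier by (simp add: c_def conj_by_conj_by H_closed(4))
    then have "comm c e" if "e \<in> H" for e
      using a that c th comm_conj_by_cancel[of h c e] comm_trivial by simp
    moreover obtain e f where "e \<in> H" "f \<in> H" "\<not> comm e f" using nonabelian by blast
    ultimately have "\<theta> c = mat 1" using comm_trans[of e c f] c comm_sym by blast
    then show False using M th w by (simp add: c_def)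
  qed
  then show ?thesis using that[of "y M"] y by (simp add: W_def)
qed

text \<open>
  The \<open>z i\<close> are chosen one after another; the conditions on \<open>z m\<close> involve only finitely many elements
  that are already known, and \<open>avoid_commuting\<close> applies. The set \<open>C\<close> is nonempty in order that
  not commuting with its elements makes every conjugate of \<open>z i\<close> nontrivial in the image, as the later
  steps require.
\<close>

lemma independent_elements:
  fixes m :: nat
  assumes D: "subgroup D G" "D \<subseteq> core"
    and nonabelian: "\<And>g. g \<in> carrier G \<Longrightarrow> \<exists>a\<in>D. \<exists>b\<in>D. \<not> comm (conj_by g a) (conj_by g b)"
    and \<Gamma>: "finite \<Gamma>" "\<Gamma> \<subseteq> carrier G"
    and C: "finite C" "C \<subseteq> core" "C \<noteq> {}"
      "\<And>g c. g \<in> \<Gamma> \<Longrightarrow> c \<in> C \<Longrightarrow> \<theta> (conj_by g c) \<noteq> mat 1"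
  obtains z :: "nat \<Rightarrow> 'a" where "\<And>i. z i \<in> D"
    and "\<And>i j g g'. i < m \<Longrightarrow> j < m \<Longrightarrow> i \<noteq> j \<Longrightarrow> g \<in> \<Gamma> \<Longrightarrow> g' \<in> \<Gamma> \<Longrightarrow>
          \<not> comm (conj_by g (z i)) (conj_by g' (z j))"
    and "\<And>i g c. i < m \<Longrightarrow> g \<in> \<Gamma> \<Longrightarrow> c \<in> C \<Longrightarrow> \<not> comm (conj_by g (z i)) (conj_by g c)"
proof -
  have "\<exists>z :: nat \<Rightarrow> 'a. (\<forall>i. z i \<in> D) \<and>
      (\<forall>i<m. \<forall>j<i. \<forall>g\<in>\<Gamma>. \<forall>g'\<in>\<Gamma>. \<not> comm (conj_by g (z i)) (conj_by g' (z j))) \<and>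
      (\<forall>i<m. \<forall>g\<in>\<Gamma>. \<forall>c\<in>C. \<not> comm (conj_by g (z i)) (conj_by g c))"
  proof (induction m)
    case 0
    show ?case using subgroup.one_closed[OF D(1)] by (intro exI[of _ "\<lambda>_. \<one>"]) auto
  next
    case (Suc m)
    then obtain z where z: "\<forall>i. z i \<in> D"
      "\<forall>i<m. \<forall>j<i. \<forall>g\<in>\<Gamma>. \<forall>g'\<in>\<Gamma>. \<not> comm (conj_by g (z i)) (conj_by g' (z j))"
      "\<forall>i<m. \<forall>g\<in>\<Gamma>. \<forall>c\<in>C. \<not> comm (conj_by g (z i)) (conj_by g c)" by blast
    define P where "P = \<Gamma> \<times> (\<lambda>(g, j). conj_by g (z j)) ` (\<Gamma> \<times> {..<m})
      \<union> (\<lambda>(g, c). (g, conj_by g c)) ` (\<Gamma> \<times> C)"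
    have "\<exists>y\<in>D. \<forall>(g, e)\<in>P. \<not> comm (conj_by g y) e"
    proof (rule avoid_commuting[OF D])
      show "finite P" using \<Gamma> C by (simp add: P_def)
      show "P \<subseteq> carrier G \<times> H"
      proof -
        have "conj_by g c \<in> H" if "g \<in> \<Gamma>" "c \<in> core" for g c
          using that \<Gamma>(2) by (intro conj_by_core_H) auto
        moreover have "z j \<in> core" for j using z(1) D(2) by blast
        ultimately show ?thesis using \<Gamma>(2) C(2) unfolding P_def by (auto 0 3)
      qed
      fix g e assume "(g, e) \<in> P"
      then consider g' j where "e = conj_by g' (z j)" "g' \<in> \<Gamma>" "j < m"
        | c where "e = conj_by g c" "g \<in> \<Gamma>" "c \<in> C"
        by (auto simp: P_def)
      then show "\<theta> e \<noteq> mat 1"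
      proof cases
        case 1
        then show ?thesis using z(3) C(3) comm_trivial by blast
      next
        case 2
        then show ?thesis using C(4) by blast
      qed
    qed (rule nonabelian)
    then obtain y where y: "y \<in> D" "\<And>g e. (g, e) \<in> P \<Longrightarrow> \<not> comm (conj_by g y) e" by blast
    have "\<not> comm (conj_by g y) (conj_by g' (z j))" if "g \<in> \<Gamma>" "g' \<in> \<Gamma>" "j < m" for g g' j
    proof (rule y(2))
      have "conj_by g' (z j) \<in> (\<lambda>(g, j). conj_by g (z j)) ` (\<Gamma> \<times> {..<m})"
        using that by (intro image_eqI[of _ _ "(g', j)"]) auto
      then show "(g, conj_by g' (z j)) \<in> P" using that by (simp add: P_def)
    qed
    moreover have "\<not> comm (conj_by g y) (conj_by g c)" if "g \<in> \<Gamma>" "c \<in> C" for g c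
    proof (rule y(2))
      have "(g, conj_by g c) \<in> (\<lambda>(g, c). (g, conj_by g c)) ` (\<Gamma> \<times> C)"
        using that by (intro image_eqI[of _ _ "(g, c)"]) auto
      then show "(g, conj_by g c) \<in> P" by (simp add: P_def)
    qed
    ultimately show ?case using y(1) z
      by (intro exI[of _ "z(m := y)"]) (auto simp: less_Suc_eq)
  qed
  then obtain z where z: "\<forall>i. z i \<in> D"
      "\<forall>i<m. \<forall>j<i. \<forall>g\<in>\<Gamma>. \<forall>g'\<in>\<Gamma>. \<not> comm (conj_by g (z i)) (conj_by g' (z j))"
      "\<forall>i<m. \<forall>g\<in>\<Gamma>. \<forall>c\<in>C. \<not> comm (conj_by g (z i)) (conj_by g c)" by blast
  have "\<not> comm (conj_by g (z i)) (conj_by g' (z j))"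
    if "i < m" "j < m" "i \<noteq> j" "g \<in> \<Gamma>" "g' \<in> \<Gamma>" for i j g g'
    using that z(2) comm_sym by (metis linorder_neqE_nat)
  then show ?thesis using that z by blast
qed

end

section \<open>Sandwiched generators\<close>

text \<open>
  The generator with index \<open>i\<close> carries a power of \<open>z (2 i)\<close> on its left and of \<open>z (2 i + 1)\<close> on its
  right. For a letter, \<open>start_index\<close> and \<open>finish_index\<close> tell which of them stands at its left and at
  its right end; inverting the letter exchanges the two.
\<close>

definition start_index :: "nat \<times> bool \<Rightarrow> nat" where
  "start_index l = (if snd l then 2 * fst l else 2 * fst l + 1)"

definition finish_index :: "nat \<times> bool \<Rightarrow> nat" where
  "finish_index l = (if snd l then 2 * fst l + 1 else 2 * fst l)"

text \<open>
  The reason for using different elements on both sides: the same \<open>z j\<close> meets itself only between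
  a letter and its inverse.
\<close>

lemma start_index_eq_finish_index: "start_index k = finish_index l \<longleftrightarrow> k = letter_inv l"
  by (auto simp: start_index_def finish_index_def letter_inv_def prod_eq_iff) presburger+

lemma index_less: "fst l < m \<Longrightarrow> start_index l < 2 * m" "fst l < m \<Longrightarrow> finish_index l < 2 * m"
  by (auto simp: start_index_def finish_index_def)

lemma freely_reduced_appendD:
  "freely_reduced (v @ w) \<Longrightarrow> freely_reduced v" "freely_reduced (v @ w) \<Longrightarrow> freely_reduced w"
  by (auto simp: freely_reduced_def successively_append_iff)

context group
begin

definition start :: "(nat \<Rightarrow> 'a) \<Rightarrow> nat \<times> bool \<Rightarrow> 'a" where
  "start z l = (if snd l then z (start_index l) else inv (z (start_index l)))"

definition finish :: "(nat \<Rightarrow> 'a) \<Rightarrow> nat \<times> bool \<Rightarrow> 'a" where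
  "finish z l = (if snd l then z (finish_index l) else inv (z (finish_index l)))"

lemma start_finish_closed [simp]:
  "(\<And>i. z i \<in> carrier G) \<Longrightarrow> start z l \<in> carrier G"
  "(\<And>i. z i \<in> carrier G) \<Longrightarrow> finish z l \<in> carrier G"
  by (simp_all add: start_def finish_def)

text \<open>
  Indices 0 and 1 are reserved for the pair that generates the subgroup containing all \<open>z i\<close>; these
  entries stay unchanged so that the powers of the \<open>z i\<close> can be removed again. For \<open>M = 0\<close>
  the tuple is \<open>x\<close>.
\<close>

definition sandwich :: "(nat \<Rightarrow> 'a) \<Rightarrow> nat \<Rightarrow> (nat \<Rightarrow> 'a) \<Rightarrow> nat \<Rightarrow> 'a" where
  "sandwich z M x i = (if i < 2 then x i else z (2 * i) [^] M \<otimes> x i \<otimes> z (2 * i + 1) [^] M)"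

lemma sandwich_closed [simp]:
  "(\<And>i. z i \<in> carrier G) \<Longrightarrow> (\<And>i. x i \<in> carrier G) \<Longrightarrow> sandwich z M x i \<in> carrier G"
  by (simp add: sandwich_def)

text \<open>
  The conjugates of the \<open>z i\<close> and their inverses whose \<open>M\<close>-th powers remain when all other factors of
  \<open>g \<otimes> tuple_eval (sandwich z M x) w\<close> are moved to the right; \<open>g\<close> accumulates what has been
  passed. The list does not depend on \<open>M\<close>.
\<close>

primrec factors :: "(nat \<Rightarrow> 'a) \<Rightarrow> (nat \<Rightarrow> 'a) \<Rightarrow> 'a \<Rightarrow> (nat \<times> bool) list \<Rightarrow> 'a list" where
  "factors z x g [] = []"
| "factors z x g (l # w) =
     (if fst l < 2 then []
      else [conj_by g (start z l), conj_by (g \<otimes> letter_value x l) (finish z l)])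
     @ factors z x (g \<otimes> letter_value x l) w"

lemma letter_value_sandwich:
  assumes "\<And>i. z i \<in> carrier G" "\<And>i. x i \<in> carrier G"
  shows "letter_value (sandwich z M x) l =
    (if fst l < 2 then letter_value x l
     else start z l [^] M \<otimes> letter_value x l \<otimes> finish z l [^] M)"
  using assms by (auto simp: letter_value_def sandwich_def start_def finish_def start_index_def
      finish_index_def inv_mult_group nat_pow_inv m_assoc)

lemma conj_by_cancel: "g \<in> carrier G \<Longrightarrow> x \<in> carrier G \<Longrightarrow> conj_by g x \<otimes> g = g \<otimes> x"
  by (simp add: conj_by_def m_assoc)

lemma factors_closed:
  assumes z: "\<And>i. z i \<in> carrier G" and x: "\<And>i. x i \<in> carrier G"
  shows "g \<in> carrier G \<Longrightarrow> set (factors z x g w) \<subseteq> carrier G"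
  by (induction w arbitrary: g) (auto simp: z x)

lemma power_product_carrier: "set rs \<subseteq> carrier G \<Longrightarrow> power_product M rs \<in> carrier G"
  by (induction rs) auto

lemma tuple_eval_sandwich:
  assumes z: "\<And>i. z i \<in> carrier G" and x: "\<And>i. x i \<in> carrier G" and g: "g \<in> carrier G"
  shows "g \<otimes> tuple_eval (sandwich z M x) w
    = power_product M (factors z x g w) \<otimes> (g \<otimes> tuple_eval x w)"
  using g
proof (induction w arbitrary: g)
  case (Cons l w)
  define c where "c = letter_value x l"
  define t where "t = tuple_eval (sandwich z M x) w"
  define p where "p = power_product M (factors z x (g \<otimes> c) w)"
  have closed: "c \<in> carrier G" "t \<in> carrier G" "tuple_eval x w \<in> carrier G" "p \<in> carrier G"
    using Cons.prems x z by (auto simp: c_def t_def p_def intro!: power_product_carrier dest!: factors_closed[THEN subsetD, rotated -1])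
  have IH: "(g \<otimes> c) \<otimes> t = p \<otimes> ((g \<otimes> c) \<otimes> tuple_eval x w)"
    using Cons.IH[of "g \<otimes> c"] Cons.prems closed by (simp add: t_def p_def)
  show ?case
  proof (cases "fst l < 2")
    case True
    then show ?thesis using IH Cons.prems closed z x
      by (simp add: letter_value_sandwich c_def[symmetric] t_def[symmetric] p_def[symmetric] m_assoc)
  next
    case False
    define s where "s = start z l [^] M"
    define f where "f = finish z l [^] M"
    have sf: "s \<in> carrier G" "f \<in> carrier G" using z by (simp_all add: s_def f_def)
    have "g \<otimes> tuple_eval (sandwich z M x) (l # w) = g \<otimes> s \<otimes> (c \<otimes> f) \<otimes> t"
      using False Cons.prems closed z x sf
      by (simp add: letter_value_sandwich c_def[symmetric] t_def[symmetric] s_def[symmetric] f_def[symmetric] m_assoc)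
    also have "g \<otimes> s = conj_by g s \<otimes> g" using Cons.prems sf by (simp add: conj_by_cancel)
    also have "conj_by g s \<otimes> g \<otimes> (c \<otimes> f) \<otimes> t = conj_by g s \<otimes> ((g \<otimes> c) \<otimes> f) \<otimes> t"
      using Cons.prems closed sf by (simp add: m_assoc)
    also have "(g \<otimes> c) \<otimes> f = conj_by (g \<otimes> c) f \<otimes> (g \<otimes> c)" using Cons.prems closed sf by (simp add: conj_by_cancel)
    also have "conj_by g s \<otimes> (conj_by (g \<otimes> c) f \<otimes> (g \<otimes> c)) \<otimes> t = conj_by g s \<otimes> conj_by (g \<otimes> c) f \<otimes> ((g \<otimes> c) \<otimes> t)"
      using Cons.prems closed sf by (simp add: m_assoc)
    also have "\<dots> = conj_by g s \<otimes> (conj_by (g \<otimes> c) f \<otimes> p) \<otimes> (g \<otimes> (c \<otimes> tuple_eval x w))"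
      unfolding IH using Cons.prems closed sf by (simp add: m_assoc)
    also have "conj_by g s \<otimes> (conj_by (g \<otimes> c) f \<otimes> p) = power_product M (factors z x g (l # w))"
      using False Cons.prems closed z
      by (simp add: c_def[symmetric] p_def[symmetric] s_def f_def conj_by_pow)
    finally show ?thesis by (simp add: c_def)
  qed
qed (use g in simp)

end

context large_action
begin

lemma comm_conj_by_start_finish:
  assumes "\<And>i. z i \<in> core" "g \<in> carrier G"
  shows "comm (conj_by g (start z l)) y \<longleftrightarrow> comm (conj_by g (z (start_index l))) y"
    and "comm (conj_by g (finish z l)) y \<longleftrightarrow> comm (conj_by g (z (finish_index l))) y"
    and "comm y (conj_by g (start z l)) \<longleftrightarrow> comm y (conj_by g (z (start_index l)))"
    and "comm y (conj_by g (finish z l)) \<longleftrightarrow> comm y (conj_by g (z (finish_index l)))"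
proof -
  show 1: "comm (conj_by g (start z l)) y \<longleftrightarrow> comm (conj_by g (z (start_index l))) y" for y
    using assms by (simp add: start_def conj_by_inv core_carrier comm_inv_iff conj_by_core_H)
  show 2: "comm (conj_by g (finish z l)) y \<longleftrightarrow> comm (conj_by g (z (finish_index l))) y" for y
    using assms by (simp add: finish_def conj_by_inv core_carrier comm_inv_iff conj_by_core_H)
  show "comm y (conj_by g (start z l)) \<longleftrightarrow> comm y (conj_by g (z (start_index l)))"
    using 1[of y] comm_sym by blast
  show "comm y (conj_by g (finish z l)) \<longleftrightarrow> comm y (conj_by g (z (finish_index l)))"
    using 2[of y] comm_sym by blast
qed

context
  fixes z x :: "nat \<Rightarrow> 'a" and m n :: nat
  assumes z: "\<And>i. z i \<in> core" and x: "\<And>i. x i \<in> carrier G" and x_core: "x 0 \<in> core" "x 1 \<in> core"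
    and n: "n > 0"
    and different: "\<And>i j v v'. \<lbrakk>i < 2 * m; j < 2 * m; i \<noteq> j; v \<in> lists ({..<m} \<times> UNIV); length v \<le> n;
        v' \<in> lists ({..<m} \<times> UNIV); length v' \<le> n\<rbrakk>
      \<Longrightarrow> \<not> comm (conj_by (tuple_eval x v) (z i)) (conj_by (tuple_eval x v') (z j))"
    and same: "\<And>i v u. \<lbrakk>i < 2 * m; v \<in> lists ({..<m} \<times> UNIV); length v \<le> n;
        u \<in> reduced_words {0, 1}; u \<noteq> []; length u \<le> n\<rbrakk>
      \<Longrightarrow> \<not> comm (conj_by (tuple_eval x v) (z i)) (conj_by (tuple_eval x v) (tuple_eval x u))"
begin

text \<open>
  The letters \<open>l\<close> and \<open>k\<close> are separated by a word \<open>u\<close> in the first two generators. If \<open>k\<close> is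
  the inverse of \<open>l\<close>, then \<open>u\<close> is nonempty, and the two elements in question are, up to inversion,
  \<open>y' = g y g\<inverse>\<close> and its conjugate by \<open>g c g\<inverse>\<close>, where \<open>c\<close> is the value of \<open>u\<close>. If these commuted, so would
  \<open>y'\<close> and \<open>g c g\<inverse>\<close>.
\<close>

lemma junction:
  assumes l: "fst l < m" and k: "fst k < m" and v: "v \<in> lists ({..<m} \<times> UNIV)"
    and u: "u \<in> lists ({0, 1} \<times> UNIV)" and m: "2 \<le> m"
    and len: "length v + length u \<le> n" and red: "freely_reduced (l # u @ [k])"
  shows "\<not> comm (conj_by (tuple_eval x v) (finish z l)) (conj_by (tuple_eval x (v @ u)) (start z k))"
proof -
  have vu: "v @ u \<in> lists ({..<m} \<times> UNIV)" using v u m by auto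
  have tc: "tuple_eval x w \<in> carrier G" for w using x by simp
  show ?thesis
  proof (cases "k = letter_inv l")
    case False
    then have "start_index k \<noteq> finish_index l" by (simp add: start_index_eq_finish_index)
    then show ?thesis using different[of "finish_index l" "start_index k" v "v @ u"] vu v len l k
      by (simp add: comm_conj_by_start_finish z tc index_less)
  next
    case True
    define g where "g = tuple_eval x v"
    define c where "c = tuple_eval x u"
    define y where "y = z (finish_index l)"
    have idx: "start_index k = finish_index l" using True by (simp add: start_index_eq_finish_index)
    have u0: "u \<noteq> []" using red True by (auto simp: freely_reduced_Cons)
    have "freely_reduced u" using red by (auto simp: freely_reduced_def successively_Cons successively_append_iff)
    then have ur: "u \<in> reduced_words {0, 1}" using u by (simp add: reduced_words_def)
    have nc: "\<not> comm (conj_by g y) (conj_by g c)"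
      using same[of "finish_index l" v u] l v u0 ur len by (simp add: index_less g_def y_def c_def)
    have gc: "g \<in> carrier G" "c \<in> carrier G" "y \<in> carrier G" using tc z core_carrier by (auto simp: g_def c_def y_def)
    have "c \<in> core" unfolding c_def
      by (rule tuple_eval_mem[OF subgroup_core]) (use u x_core in auto)
    then have H: "conj_by g y \<in> H" "conj_by g c \<in> H" using gc z by (auto simp: y_def intro!: conj_by_core_H)
    have "conj_by (tuple_eval x (v @ u)) y = conj_by (g \<otimes> c) y" using x by (simp add: tuple_eval_append g_def c_def)
    also have "\<dots> = conj_by (conj_by g c \<otimes> g) y" using gc by (simp add: conj_by_cancel)
    also have "\<dots> = conj_by (conj_by g c) (conj_by g y)" using gc by (simp add: conj_by_conj_by)
    finally have "\<not> comm (conj_by g y) (conj_by (tuple_eval x (v @ u)) y)"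
      using nc comm_if_comm_conj_by[OF H] by metis
    then show ?thesis by (simp add: comm_conj_by_start_finish z tc idx g_def y_def)
  qed
qed

text \<open>
  When the lemma is used, \<open>l\<close> is the last letter of index at least 2 that has been read, \<open>v\<close> is the word up to and
  including \<open>l\<close>, and \<open>u\<close> is what has been read since then. The length bound keeps all conjugating
  elements among the values of short words.
\<close>

lemma factors_noncommuting_after:
  assumes "fst l < m" "u \<in> lists ({0, 1} \<times> UNIV)" "v \<in> lists ({..<m} \<times> UNIV)"
    "w \<in> lists ({..<m} \<times> UNIV)" "2 \<le> m" "length v + length u + length w \<le> n"
    "freely_reduced (l # u @ w)"
  shows "successively (\<lambda>r s. \<not> comm r s)
    (conj_by (tuple_eval x v) (finish z l) # factors z x (tuple_eval x (v @ u)) w)"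
  using assms
proof (induction w arbitrary: l u v)
  case (Cons k w)
  have te: "tuple_eval x (v @ u) \<otimes> letter_value x k = tuple_eval x (v @ u @ [k])"
    using x by (simp add: tuple_eval_append m_assoc)
  have tc: "tuple_eval x w \<in> carrier G" for w using x by simp
  show ?case
  proof (cases "fst k < 2")
    case True
    then have "u @ [k] \<in> lists ({0, 1} \<times> UNIV)" using Cons.prems by (cases k) auto
    then show ?thesis using Cons.IH[of l "u @ [k]" v] Cons.prems True by (simp add: te)
  next
    case False
    have k: "fst k < m" using Cons.prems by auto
    have vuk: "v @ u \<in> lists ({..<m} \<times> UNIV)" "v @ u @ [k] \<in> lists ({..<m} \<times> UNIV)"
      using Cons.prems k by (auto simp: mem_Times_iff)
    have r1: "freely_reduced (l # u @ [k])" "freely_reduced (k # w)"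
      using Cons.prems(7) freely_reduced_appendD[of "l # u @ [k]" w] freely_reduced_appendD[of "l # u" "k # w"]
      by simp_all
    have j: "\<not> comm (conj_by (tuple_eval x v) (finish z l)) (conj_by (tuple_eval x (v @ u)) (start z k))"
      by (rule junction) (use Cons.prems k r1 in auto)
    have "start_index k \<noteq> finish_index k" by (simp add: start_index_def finish_index_def)
    then have i: "\<not> comm (conj_by (tuple_eval x (v @ u)) (start z k)) (conj_by (tuple_eval x (v @ u @ [k])) (finish z k))"
      using different[of "start_index k" "finish_index k" "v @ u" "v @ u @ [k]"] vuk k Cons.prems(6)
      by (simp add: comm_conj_by_start_finish z tc index_less)
    have "successively (\<lambda>r s. \<not> comm r s)
        (conj_by (tuple_eval x (v @ u @ [k])) (finish z k) # factors z x (tuple_eval x (v @ u @ [k])) w)"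
      using Cons.IH[of k "[]" "v @ u @ [k]"] Cons.prems k vuk r1 by simp
    then show ?thesis using False j i by (simp add: te)
  qed
qed simp

lemma factors_noncommuting:
  assumes "v \<in> lists ({..<m} \<times> UNIV)" "w \<in> lists ({..<m} \<times> UNIV)" "2 \<le> m"
    "length v + length w \<le> n" "freely_reduced w"
  shows "successively (\<lambda>r s. \<not> comm r s) (factors z x (tuple_eval x v) w)"
  using assms
proof (induction w arbitrary: v)
  case (Cons k w)
  have te: "tuple_eval x v \<otimes> letter_value x k = tuple_eval x (v @ [k])"
    using x by (simp add: tuple_eval_append)
  have tc: "tuple_eval x w \<in> carrier G" for w using x by simp
  have k: "fst k < m" "v @ [k] \<in> lists ({..<m} \<times> UNIV)" using Cons.prems by (auto simp: mem_Times_iff)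
  show ?case
  proof (cases "fst k < 2")
    case True
    then show ?thesis using Cons.IH[of "v @ [k]"] Cons.prems k by (simp add: te freely_reduced_Cons)
  next
    case False
    have "start_index k \<noteq> finish_index k" by (simp add: start_index_def finish_index_def)
    then have i: "\<not> comm (conj_by (tuple_eval x v) (start z k)) (conj_by (tuple_eval x (v @ [k])) (finish z k))"
      using different[of "start_index k" "finish_index k" v "v @ [k]"] k Cons.prems
      by (simp add: comm_conj_by_start_finish z tc index_less)
    have "successively (\<lambda>r s. \<not> comm r s)
        (conj_by (tuple_eval x (v @ [k])) (finish z k) # factors z x (tuple_eval x (v @ [k])) w)"
      using factors_noncommuting_after[of k "[]" "v @ [k]" w] Cons.prems k by simp
    then show ?thesis using False i by (simp add: te)
  qed
qed simp

lemma factors_nontrivial: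
  assumes "v \<in> lists ({..<m} \<times> UNIV)" "w \<in> lists ({..<m} \<times> UNIV)"
    "length v + length w \<le> n" "r \<in> set (factors z x (tuple_eval x v) w)"
  shows "r \<in> H \<and> \<theta> r \<noteq> mat 1"
  using assms
proof (induction w arbitrary: v)
  case (Cons k w)
  have te: "tuple_eval x v \<otimes> letter_value x k = tuple_eval x (v @ [k])"
    using x by (simp add: tuple_eval_append)
  have tc: "tuple_eval x w \<in> carrier G" for w using x by simp
  have k: "fst k < m" "v @ [k] \<in> lists ({..<m} \<times> UNIV)" using Cons.prems by (auto simp: mem_Times_iff)
  have sf: "start z k \<in> core" "finish z k \<in> core"
    using z subgroup.m_inv_closed[OF subgroup_core] by (auto simp: start_def finish_def)
  have u: "[(0, True)] \<in> reduced_words {0, 1::nat}" by (simp add: reduced_words_def freely_reduced_Cons)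
  have "\<not> comm (conj_by (tuple_eval x v) (start z k)) (conj_by (tuple_eval x v) (tuple_eval x [(0, True)]))"
    using same[of "start_index k" v "[(0, True)]"] k Cons.prems u n
    by (simp add: comm_conj_by_start_finish z tc index_less)
  then have 1: "\<theta> (conj_by (tuple_eval x v) (start z k)) \<noteq> mat 1" using comm_trivial by blast
  have "\<not> comm (conj_by (tuple_eval x (v @ [k])) (finish z k)) (conj_by (tuple_eval x (v @ [k])) (tuple_eval x [(0, True)]))"
    using same[of "finish_index k" "v @ [k]" "[(0, True)]"] k Cons.prems u n
    by (simp add: comm_conj_by_start_finish z tc index_less)
  then have 2: "\<theta> (conj_by (tuple_eval x (v @ [k])) (finish z k)) \<noteq> mat 1" using comm_trivial by blast
  show ?case
    using Cons.prems(4) 1 2 conj_by_core_H[OF tc sf(1)] conj_by_core_H[OF tc sf(2)] Cons.IH[of "v @ [k]"] Cons.prems k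
    by (auto simp: te split: if_splits)
qed simp

lemma factors_nonempty: "\<exists>l\<in>set w. 2 \<le> fst l \<Longrightarrow> factors z x g w \<noteq> []"
  by (induction w arbitrary: g) auto

text \<open>
  If the word were trivial, the product of powers would be the inverse of the value of \<open>w\<close> at the
  original tuple, which does not depend on \<open>M\<close>.
\<close>

lemma sandwich_eventually_nontrivial:
  assumes w: "w \<in> reduced_words {..<m}" "length w \<le> n" "2 \<le> m" and large: "\<exists>l\<in>set w. 2 \<le> fst l"
  shows "\<forall>\<^sub>F M in sequentially. tuple_eval (sandwich z M x) w \<noteq> \<one>"
proof -
  have zc: "z i \<in> carrier G" for i using z core_carrier by blast
  define rs where "rs = factors z x \<one> w"
  have w': "w \<in> lists ({..<m} \<times> UNIV)" "freely_reduced w" using w(1) by (auto simp: reduced_words_def)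
  have rs: "r \<in> H \<and> \<theta> r \<noteq> mat 1" if "r \<in> set rs" for r
    using factors_nontrivial[of "[]" w r] w' w(2) that by (simp add: rs_def)
  have nc: "successively (\<lambda>r s. \<not> comm r s) rs"
    using factors_noncommuting[of "[]" w] w' w by (simp add: rs_def)
  have "\<forall>\<^sub>F M in sequentially. \<theta> (power_product M rs) \<noteq> \<theta> (inv (tuple_eval x w))"
  proof (rule power_product_eventually_neq)
    show "rs \<noteq> []" using factors_nonempty[OF large] by (simp add: rs_def)
    show "successively (\<lambda>r s. r = s \<or> \<not> comm r s) rs" using nc by (rule successively_mono) blast
  qed (use rs in auto)
  then show ?thesis
  proof (rule eventually_mono)
    fix M assume a: "\<theta> (power_product M rs) \<noteq> \<theta> (inv (tuple_eval x w))"
    show "tuple_eval (sandwich z M x) w \<noteq> \<one>"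
    proof
      assume "tuple_eval (sandwich z M x) w = \<one>"
      then have "power_product M rs \<otimes> tuple_eval x w = \<one>"
        using tuple_eval_sandwich[of z x \<one> M w] zc x by (simp add: rs_def)
      moreover have "power_product M rs \<in> carrier G" 
        using rs by (intro power_product_carrier) (auto intro: H_closed(4))
      ultimately have "power_product M rs = inv (tuple_eval x w)"
        using x inv_equality by (metis inv_inv tuple_eval_closed)
      then show False using a by simp
    qed
  qed
qed

end

end

section \<open>Generating sets without short relations\<close>

context large_action
begin

text \<open>
  Words in the first two generators alone are nontrivial by the choice of \<open>h\<close>, and all other reduced words
  become nontrivial for large \<open>M\<close>. The bound is raised by 4 so that it covers the
  commutator of \<open>h 0\<close> and \<open>h 1\<close>, whose nontriviality makes the image of \<open>D\<close> noncommutative.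
\<close>

theorem short_relations_avoidable:
  assumes fg: "finite_generating_sets G \<noteq> {}"
  shows "\<exists>S\<in>finite_generating_sets G. enat n \<le> girth_wrt G S"
proof -
  define N where "N = n + 4"
  obtain S0 where S0: "finite S0" "S0 \<subseteq> carrier G" "generate G S0 = carrier G"
    using fg by (auto simp: finite_generating_sets_def)
  obtain f and k :: nat where f: "S0 = f ` {i. i < k}"
    using S0(1) by (auto simp: finite_conv_nat_seg_image)
  define m where "m = k + 2"
  obtain h :: "nat \<Rightarrow> 'a" where h: "\<And>i. h i \<in> core"
    "\<And>g w. g \<in> carrier G \<Longrightarrow> w \<in> reduced_words {0,1} \<Longrightarrow> w \<noteq> [] \<Longrightarrow> length w \<le> N \<Longrightarrow>
      \<theta> (conj_by g (tuple_eval h w)) \<noteq> mat 1"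
    using free_pair[of N] by metis
  define x where "x i = (if i < 2 then h i else if i < m then f (i - 2) else \<one>)" for i
  have x: "x i \<in> carrier G" for i
    using h(1) core_carrier S0(2) f by (auto simp: x_def m_def)
  have xh: "tuple_eval x u = tuple_eval h u" if "u \<in> lists ({0, 1} \<times> UNIV)" for u
    by (rule tuple_eval_cong) (use that in \<open>auto simp: x_def\<close>)
  define W where "W = {w \<in> reduced_words {..<m}. w \<noteq> [] \<and> length w \<le> N}"
  have finW: "finite W"
    by (rule finite_subset[OF _ finite_short_words[of "{..<m}" N]]) (auto simp: W_def reduced_words_def)
  \<comment> \<open>The conjugating elements that can occur depend on \<open>h\<close> and \<open>f\<close> only, so \<open>z\<close> can be adapted to them.\<close>
  define \<Gamma> where "\<Gamma> = tuple_eval x ` {v \<in> lists ({..<m} \<times> UNIV). length v \<le> N}"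
  have \<Gamma>: "finite \<Gamma>" "\<Gamma> \<subseteq> carrier G"
    using finite_short_words[of "{..<m}" N] x by (auto simp: \<Gamma>_def)
  define C where "C = tuple_eval h ` {u \<in> reduced_words {0, 1}. u \<noteq> [] \<and> length u \<le> N}"
  have "finite {u \<in> reduced_words {0, 1::nat}. u \<noteq> [] \<and> length u \<le> N}"
    by (rule finite_subset[OF _ finite_short_words[of "{0,1}" N]]) (auto simp: reduced_words_def)
  then have "finite C" by (simp add: C_def)
  define D where "D = generate G (h ` {0, 1})"
  have D: "subgroup D G" "D \<subseteq> core"
    using h(1) core_carrier generate_is_subgroup[of "h ` {0, 1}"]
      generate_subgroup_incl[OF _ subgroup_core, of "h ` {0, 1}"]
    by (auto simp: D_def)
  have hD: "h 0 \<in> D" "h 1 \<in> D" by (auto simp: D_def intro: generate.incl)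
  have "C \<subseteq> D" unfolding C_def
  proof clarify
    fix u assume "u \<in> reduced_words {0, 1::nat}"
    then show "tuple_eval h u \<in> D"
      by (intro tuple_eval_mem[OF D(1)]) (use hD in \<open>auto simp: reduced_words_def\<close>)
  qed
  have "[(0, True)] \<in> reduced_words {0, 1::nat}" by (simp add: reduced_words_def freely_reduced_Cons)
  then have "C \<noteq> {}" by (auto simp: C_def N_def intro!: exI[of _ "[(0, True)]"])
  have nonab: "\<exists>a\<in>D. \<exists>b\<in>D. \<not> comm (conj_by g a) (conj_by g b)" if g: "g \<in> carrier G" for g
  proof -
    define w where "w = [(0, True), (1, True), (0, False), (1::nat, False)]"
    have "w \<in> reduced_words {0, 1}"
      by (simp add: w_def reduced_words_def freely_reduced_Cons letter_inv_def)
    then have nt: "\<theta> (conj_by g (tuple_eval h w)) \<noteq> mat 1" using h(2)[OF g, of w] by (simp add: w_def N_def)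
    define a b where "a = conj_by g (h 0)" and "b = conj_by g (h 1)"
    have ab: "a \<in> H" "b \<in> H" using h(1) g by (auto simp: a_def b_def intro!: conj_by_core_H)
    have "conj_by g (tuple_eval h w) = (a \<otimes> b) \<otimes> (inv a \<otimes> inv b)"
      using g h(1) core_carrier
      by (simp add: w_def letter_value_def a_def b_def conj_by_mult conj_by_inv m_assoc)
    moreover have "\<theta> ((a \<otimes> b) \<otimes> (inv a \<otimes> inv b)) = mat 1" if "comm a b"
    proof -
      have "\<theta> ((a \<otimes> b) \<otimes> (inv a \<otimes> inv b)) = \<theta> ((b \<otimes> a) \<otimes> (inv a \<otimes> inv b))"
        using that ab by (simp add: \<theta>_mult comm_def)
      also have "(b \<otimes> a) \<otimes> (inv a \<otimes> inv b) = \<one>"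
        using ab H_closed(4) by (simp add: inv_mult_group[symmetric])
      finally show ?thesis by simp
    qed
    ultimately have "\<not> comm a b" using nt by metis
    then show ?thesis using hD by (auto simp: a_def b_def)
  qed
  have Cnt: "\<theta> (conj_by g c) \<noteq> mat 1" if "g \<in> \<Gamma>" "c \<in> C" for g c
    using that h(2) \<Gamma>(2) by (auto simp: C_def)
  have "C \<subseteq> core" using \<open>C \<subseteq> D\<close> D(2) by blast
  obtain z :: "nat \<Rightarrow> 'a" where z: "\<And>i. z i \<in> D"
    and z1: "\<And>i j g g'. i < 2 * m \<Longrightarrow> j < 2 * m \<Longrightarrow> i \<noteq> j \<Longrightarrow> g \<in> \<Gamma> \<Longrightarrow> g' \<in> \<Gamma> \<Longrightarrow>
          \<not> comm (conj_by g (z i)) (conj_by g' (z j))"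
    and z2: "\<And>i g c. i < 2 * m \<Longrightarrow> g \<in> \<Gamma> \<Longrightarrow> c \<in> C \<Longrightarrow> \<not> comm (conj_by g (z i)) (conj_by g c)"
    using independent_elements[OF D nonab \<Gamma> \<open>finite C\<close> \<open>C \<subseteq> core\<close> \<open>C \<noteq> {}\<close> Cnt, of "2 * m"] by metis
  have zc: "z i \<in> core" "z i \<in> carrier G" for i using z D(2) core_carrier by blast+
  have "\<forall>\<^sub>F M in sequentially. tuple_eval (sandwich z M x) w \<noteq> \<one>" if w: "w \<in> W" for w
  proof (cases "\<exists>l\<in>set w. 2 \<le> fst l")
    case True
    show ?thesis
    proof (rule sandwich_eventually_nontrivial[where m = m and n = N])
      show "x 0 \<in> core" "x 1 \<in> core" using h(1) by (simp_all add: x_def)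
      show "\<not> comm (conj_by (tuple_eval x v) (z i)) (conj_by (tuple_eval x v') (z j))"
        if "i < 2 * m" "j < 2 * m" "i \<noteq> j" "v \<in> lists ({..<m} \<times> UNIV)" "length v \<le> N"
          "v' \<in> lists ({..<m} \<times> UNIV)" "length v' \<le> N" for i j v v'
        using z1 that by (simp add: \<Gamma>_def)
      show "\<not> comm (conj_by (tuple_eval x v) (z i)) (conj_by (tuple_eval x v) (tuple_eval x u))"
        if "i < 2 * m" "v \<in> lists ({..<m} \<times> UNIV)" "length v \<le> N"
          "u \<in> reduced_words {0, 1}" "u \<noteq> []" "length u \<le> N" for i v u
      proof -
        have "tuple_eval x u \<in> C" using that xh by (auto simp: C_def reduced_words_def)
        then show ?thesis using z2 that by (simp add: \<Gamma>_def)
      qed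
      show "z i \<in> core" "x i \<in> carrier G" for i by (fact zc x)+
    qed (use w True in \<open>auto simp: W_def N_def m_def\<close>)
  next
    case False
    have u: "w \<in> lists ({0, 1} \<times> UNIV)" "freely_reduced w" "w \<noteq> []" "length w \<le> N"
      using w False by (fastforce simp: W_def reduced_words_def)+
    have "tuple_eval (sandwich z M x) w = tuple_eval h w" for M
      by (rule tuple_eval_cong) (use False in \<open>auto simp: sandwich_def x_def\<close>)
    moreover have "tuple_eval h w \<noteq> \<one>"
      using h(2)[of \<one> w] u by (auto simp: reduced_words_def)
    ultimately show ?thesis by simp
  qed
  then have "\<forall>\<^sub>F M in sequentially. \<forall>w\<in>W. tuple_eval (sandwich z M x) w \<noteq> \<one>"
    using finW by (intro eventually_ball_finite ballI)
  then obtain M where M: "\<And>w. w \<in> W \<Longrightarrow> tuple_eval (sandwich z M x) w \<noteq> \<one>"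
    using eventually_happens'[OF sequentially_bot] by blast
  define y where "y = sandwich z M x"
  define S where "S = y ` {..<m}"
  have y: "y i \<in> carrier G" for i using zc x by (simp add: y_def)
  have S: "finite S" "S \<subseteq> carrier G" using y by (auto simp: S_def)
  have gS: "subgroup (generate G S) G" using S(2) by (rule generate_is_subgroup)
  have yS: "y i \<in> generate G S" if "i < m" for i using that by (auto simp: S_def intro: generate.incl)
  have "h i \<in> generate G S" if "i < 2" for i
    using yS[of i] that by (simp add: y_def sandwich_def x_def m_def)
  then have "D \<subseteq> generate G S" unfolding D_def
    by (intro generate_subgroup_incl[OF _ gS]) auto
  then have zS: "z i [^] M \<in> generate G S" for i
    using z by (intro subgroup_nat_pow_closed[OF gS]) auto
  have "f i \<in> generate G S" if i: "i < k" for i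
  proof -
    define a b where "a = z (2 * (i + 2)) [^] M" and "b = z (2 * (i + 2) + 1) [^] M"
    have ab: "a \<in> carrier G" "b \<in> carrier G" "a \<in> generate G S" "b \<in> generate G S"
      using zc zS by (auto simp: a_def b_def)
    have fi: "f i \<in> carrier G" using f S0(2) i by auto
    have "y (i + 2) = a \<otimes> f i \<otimes> b" using i by (simp add: y_def sandwich_def x_def m_def a_def b_def)
    \<comment> \<open>Each original generator is recovered by stripping off the powers of elements of \<open>D\<close>.\<close>
    then have "inv a \<otimes> y (i + 2) \<otimes> inv b = (inv a \<otimes> a) \<otimes> f i \<otimes> (b \<otimes> inv b)"
      using ab fi by (simp only: m_assoc inv_closed m_closed)
    then have "f i = inv a \<otimes> y (i + 2) \<otimes> inv b" using ab fi by simp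
    then show ?thesis using ab yS[of "i + 2"] i gS
      by (simp add: m_def subgroup.m_closed subgroup.m_inv_closed)
  qed
  then have "S0 \<subseteq> generate G S" by (auto simp: f)
  then have "generate G S0 \<subseteq> generate G S" by (rule generate_subgroup_incl[OF _ gS])
  then have "generate G S = carrier G" using S0(3) generate_incl[OF S(2)] by blast
  then have "S \<in> finite_generating_sets G" using S by (simp add: finite_generating_sets_def)
  moreover have "enat N \<le> girth_wrt G S" unfolding S_def
    by (rule girth_wrt_image_ge) (use y M in \<open>auto simp: N_def W_def y_def\<close>)
  then have "enat n \<le> girth_wrt G S" by (rule order_trans[rotated]) (simp add: N_def)
  ultimately show ?thesis by blast
qed

theorem girth_infinite:
  assumes "finite_generating_sets G \<noteq> {}"
  shows "girth G = \<infinity>"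
proof -
  have "enat n \<le> girth G" for n
    using short_relations_avoidable[OF assms, of n] unfolding girth_def
    by (meson SUP_upper2)
  then show ?thesis by (metis enat_ord_simps(1) not_infinity_eq not_less_eq_eq order_refl)
qed

end

lemma large_group_large_action:
  assumes "large_group G"
  obtains H \<theta> where "large_action G H \<theta>"
proof -
  obtain H \<phi> where G: "group G" and H: "subgroup H G" "finite (rcosets\<^bsub>G\<^esub> H)"
    and \<phi>: "\<phi> \<in> epi (G\<lparr>carrier := H\<rparr>) (free_group {0, 1 :: nat})"
    using assms by (auto simp: large_group_def)
  have hom: "\<phi> (x \<otimes>\<^bsub>G\<^esub> y) = free_reduce (\<phi> x @ \<phi> y)" if "x \<in> H" "y \<in> H" for x y
    using \<phi> that by (auto simp: epi_def hom_def free_group_def)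
  have surj: "\<phi> ` H = reduced_words {0, 1}" using \<phi> by (simp add: epi_def free_group_def)
  define \<theta> where "\<theta> = word_matrix \<circ> \<phi>"
  interpret group G by (rule G)
  interpret purely_hyperbolic G H \<theta>
  proof (intro purely_hyperbolic.intro purely_hyperbolic_axioms.intro)
    show "group G" by (rule G)
    show "subgroup H G" by (rule H)
    show "\<theta> (x \<otimes>\<^bsub>G\<^esub> y) = \<theta> x ** \<theta> y" if "x \<in> H" "y \<in> H" for x y
      using hom[OF that] by (simp add: \<theta>_def word_matrix_free_reduce word_matrix_append)
    show "\<theta> x = mat 1 \<or> hyperbolic (\<theta> x)" if "x \<in> H" for x
    proof -
      have "\<phi> x \<in> reduced_words {0, 1}" using surj that by blast
      then show ?thesis using hyperbolic_word_matrix[of "\<phi> x"] by (cases "\<phi> x = []") (auto simp: \<theta>_def)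
    qed
  qed
  have "[(0, True)] \<in> \<phi> ` H" "[(1, True)] \<in> \<phi> ` H"
    by (simp_all add: surj reduced_words_def freely_reduced_Cons)
  then obtain a b where ab: "a \<in> H" "b \<in> H" "\<phi> a = [(0, True)]" "\<phi> b = [(1, True)]" by auto
  have "letter_matrix (0, True) ** letter_matrix (1, True) \<noteq> letter_matrix (1, True) ** letter_matrix (0, True)"
    by (simp add: letter_matrix_def mat2_simps)
  then have "\<not> comm a b" unfolding comm_def using ab by (simp add: \<theta>_def)
  then have "large_action G H \<theta>" using H(2) ab by unfold_locales blast+
  then show ?thesis using that by blast
qed

theorem corollary2p2:
  fixes G :: "('a, 'b) monoid_scheme"
  assumes "finitely_generated_group G"
    and "large_group G"
  shows "girth G = \<infinity>"
proof -
  obtain H \<theta> where "large_action G H \<theta>" using large_group_large_action[OF assms(2)] .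
  moreover have "finite_generating_sets G \<noteq> {}"
    using assms(1) by (simp add: finitely_generated_group_def)
  ultimately show ?thesis by (rule large_action.girth_infinite)
qed

end
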